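(* The following hold: (1) For $n\geq 4$, $\mathbf{Cl}(P_{\mathrm{SCF}}(B))\subseteq\mathbf{Cl}(P_{\mathrm{DL}}(D))\subseteq\mathbf{Cl}(P_{\mathrm{DL}}(V_{\mathrm{MTZ}}))\subseteq\mathbf{Cl}(P_{\mathrm{MTZ}}(D))$. (2) For $n=4$, $\mathbf{Cl}(P_{\mathrm{SCF}}(B))=\mathbf{Cl}(P_{\mathrm{DL}}(D))=\mathbf{Cl}(P_{\mathrm{DL}}(V_{\mathrm{MTZ}}))=\mathbf{Cl}(P_{\mathrm{MTZ}}(D))$. (3) For $n\geq 5$, for any $\hat C\in\mathcal C_1$ with $3\leq|\hat C|\leq n-2$ and for any node $k$ of $\hat C$, there exists $\hat x\in \mathbf{Cl}(P_{\mathrm{MTZ}}(D))$ that violates $\sum_{ij\in \hat C}(x_{ij}+x_{ji})-x_{k^+k}-x_{kk^-}\leq |\hat C|-1$, where $k^-$ and $k^+$ are the nodes preceding and succeeding $k$ in $\hat C$. In particular, $\mathbf{Cl}(P_{\mathrm{DL}}(V_{\mathrm{MTZ}}))\subsetneq \mathbf{Cl}(P_{\mathrm{MTZ}}(D))$. (4) For $n\geq 5$, for any $\hat C\in\mathcal C_1$ with $3\leq|\hat C|\leq n-2$ and for any arc $kl\in \hat C$, there exists $\hat x\in \mathbf{Cl}(P_{\mathrm{DL}}(V_{\mathrm{MTZ}}))$ that violates $\sum_{ij\in \hat C}(x_{ij}+x_{ji})-x_{lk}\leq |\hat C|-1$. In particular, $\mathbf{Cl}(P_{\mathrm{DL}}(D))\subsetneq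 \mathbf{Cl}(P_{\mathrm{DL}}(V_{\mathrm{MTZ}}))$. (5) For $n\geq 5$, for any $\hat S\in\mathcal S_1$ with $3\leq|\hat S|\leq n-2$, there exists $\hat x\in \mathbf{Cl}(P_{\mathrm{DL}}(D))$ that violates $\sum_{ij\in A(\hat S)}x_{ij}\leq |\hat S|-1$. In particular, $\mathbf{Cl}(P_{\mathrm{SCF}}(B))\subsetneq \mathbf{Cl}(P_{\mathrm{DL}}(D))$.
   Context: Let $n\ge 4$, $N=\{1,\dots,n\}$, $A=\{ij : i,j\in N,\ i\ne j\}$, $N_1=N\setminus\{1\}$, $A_1=\{ij : i,j\in N_1,\ i\neq j\}$. $\mathcal C_1$ is the set of (simple) directed cycles with arcs in $A_1$, each of length at least 2 and identified with its set of arcs; $|C|$ is the number of arcs. $\mathcal S_1$ is the set of subsets of $N_1$ of size at least 2, and $A(S)=\{ij\in A : i,j\in S\}$. $\delta^+(i)$, $\delta^-(i)$ are the sets of arcs leaving, entering node $i$. $P_{\mathrm{AP}}$ is the set of $x\in[0,1]^A$ with $\sum_{j\neq i}x_{ij}=1$ and $\sum_{j\ne i}x_{ji}=1$ for all $i\in N$. With $\mathbb R_{++}$ the positive reals and $\mathbb R_+$ the nonnegative reals, $D=\{d\in\mathbb R_{++}^{A_1} : \sum_{ij\in C}d_{ij}\le 1\ \forall C\in\mathcal C_1\}$, $\overline D=\{d\in\mathbb R_{+}^{A_1} : \sum_{ij\in C}d_{ij}\le 1\ \forall C\in\mathcal C_1\}$, and $B=\{b\in\mathbb R_{++}^{N_1}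 : \sum_{i\in N_1}b_i=1\}$. For $d\in\overline D$: $P_{\mathrm{MTZ}}(d)$ is the set of $x\in P_{\mathrm{AP}}$ for which there is $u\in\mathbb R^{N_1}$ with $u_i-u_j+d_{ij}\le 1-x_{ij}$ for all $ij\in A_1$; $P_{\mathrm{DL}}(d)$ is the set of $x\in P_{\mathrm{AP}}$ for which there is $u\in\mathbb R^{N_1}$ with $u_i-u_j+x_{ij}+(1-d_{ij}-d_{ji})x_{ji}\le 1-d_{ij}$ for all $ij\in A_1$. For $b\in B$: $P_{\mathrm{SCF}}(b)$ is the set of $x\in P_{\mathrm{AP}}$ for which there is $f\in\mathbb R^A_+$ with $\sum_{ij\in\delta^+(i)}f_{ij}-\sum_{ji\in\delta^-(i)}f_{ji}=-b_i$ for all $i\in N_1$ and $f_{ij}\le x_{ij}$ for all $ij\in A$. For a set of parameters $\mathcal P$, $\mathbf{Cl}(P_{\bullet}(\mathcal P))=\bigcap_{p\in\mathcal P}P_{\bullet}(p)$ for $\bullet\in\{\mathrm{MTZ},\mathrm{DL},\mathrm{SCF}\}$. $V_{\mathrm{MTZ}}=\{d^k : k\in N_1\}\subseteq\overline D$, where $d^k_{ij}=1$ if $i=k$ and $d^k_{ij}=0$ if $i\neq k$. *)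

theory Defs
  imports Complex_Main "HOL-Library.FuncSet" "HOL-Library.Multiset" "Graph_Theory.Pair_Digraph"
begin

text \<open>
  A real vector indexed by a finite set I is an extensional function on I (an element
  of a set of the form \<open>I \<rightarrow>\<^sub>E S\<close>), so that equality of vectors and equality of
  polyhedra mean equality of the coordinates in I.
\<close>

definition nodes :: "nat \<Rightarrow> nat set" where
  "nodes n = {1..n}"

definition nodes1 :: "nat \<Rightarrow> nat set" where
  "nodes1 n = nodes n - {1}"

definition arcs_between :: "nat set \<Rightarrow> (nat \<times> nat) set" where
  "arcs_between S = {(i, j). i \<in> S \<and> j \<in> S \<and> i \<noteq> j}"

abbreviation arcsA :: "nat \<Rightarrow> (nat \<times> nat) set" where
  "arcsA n \<equiv> arcs_between (nodes n)"

abbreviation arcsA1 :: "nat \<Rightarrow> (nat \<times> nat) set" where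
  "arcsA1 n \<equiv> arcs_between (nodes1 n)"

definition complete_on :: "nat set \<Rightarrow> (nat, nat \<times> nat) pre_digraph" where
  "complete_on S = with_proj \<lparr> pverts = S, parcs = arcs_between S \<rparr>"

abbreviation leaving :: "nat \<Rightarrow> nat \<Rightarrow> (nat \<times> nat) set" where
  "leaving n i \<equiv> out_arcs (complete_on (nodes n)) i"

abbreviation entering :: "nat \<Rightarrow> nat \<Rightarrow> (nat \<times> nat) set" where
  "entering n i \<equiv> in_arcs (complete_on (nodes n)) i"

text \<open>
  A library cycle is a nonempty closed arc list without repeated nodes; we pass to its set
  of arcs. As there are no loops, its length is at least 2, and it equals the cardinality
  of the arc set.
\<close>

definition cycles1 :: "nat \<Rightarrow> (nat \<times> nat) set set" where
  "cycles1 n = {set p | p. pre_digraph.cycle (complete_on (nodes1 n)) p}"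

text \<open>The nodes of a cycle C are \<open>Field C\<close>; each has a unique successor and predecessor.\<close>

definition cycle_succ :: "(nat \<times> nat) set \<Rightarrow> nat \<Rightarrow> nat" where
  "cycle_succ C k = (THE j. (k, j) \<in> C)"

definition cycle_pred :: "(nat \<times> nat) set \<Rightarrow> nat \<Rightarrow> nat" where
  "cycle_pred C k = (THE i. (i, k) \<in> C)"

definition node_sets1 :: "nat \<Rightarrow> nat set set" where
  "node_sets1 n = {S. S \<subseteq> nodes1 n \<and> card S \<ge> 2}"

definition arcs_in :: "nat \<Rightarrow> nat set \<Rightarrow> (nat \<times> nat) set" where
  "arcs_in n S = {(i, j) \<in> arcsA n. i \<in> S \<and> j \<in> S}"

definition P_AP :: "nat \<Rightarrow> (nat \<times> nat \<Rightarrow> real) set" where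
  "P_AP n = {x \<in> arcsA n \<rightarrow>\<^sub>E {0..1}.
     (\<forall>i\<in>nodes n. (\<Sum>j\<in>nodes n - {i}. x (i, j)) = 1) \<and>
     (\<forall>i\<in>nodes n. (\<Sum>j\<in>nodes n - {i}. x (j, i)) = 1)}"

definition D_set :: "nat \<Rightarrow> (nat \<times> nat \<Rightarrow> real) set" where
  "D_set n = {d \<in> arcsA1 n \<rightarrow>\<^sub>E {0<..}. \<forall>C\<in>cycles1 n. (\<Sum>a\<in>C. d a) \<le> 1}"

definition Dbar_set :: "nat \<Rightarrow> (nat \<times> nat \<Rightarrow> real) set" where
  "Dbar_set n = {d \<in> arcsA1 n \<rightarrow>\<^sub>E {0..}. \<forall>C\<in>cycles1 n. (\<Sum>a\<in>C. d a) \<le> 1}"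

definition B_set :: "nat \<Rightarrow> (nat \<Rightarrow> real) set" where
  "B_set n = {b \<in> nodes1 n \<rightarrow>\<^sub>E {0<..}. (\<Sum>i\<in>nodes1 n. b i) = 1}"

definition d_MTZ :: "nat \<Rightarrow> nat \<Rightarrow> nat \<times> nat \<Rightarrow> real" where
  "d_MTZ n k = restrict (\<lambda>(i, j). if i = k then 1 else 0) (arcsA1 n)"

definition V_MTZ :: "nat \<Rightarrow> (nat \<times> nat \<Rightarrow> real) set" where
  "V_MTZ n = {d_MTZ n k | k. k \<in> nodes1 n}"

text \<open>
  The families \<open>P_MTZ\<close> and \<open>P_DL\<close> are meant for parameters in \<open>Dbar_set\<close>, and \<open>P_SCF\<close> for
  parameters in \<open>B_set\<close>.
\<close>

definition P_MTZ :: "nat \<Rightarrow> (nat \<times> nat \<Rightarrow> real) \<Rightarrow> (nat \<times> nat \<Rightarrow> real) set" where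
  "P_MTZ n d = {x \<in> P_AP n. \<exists>u \<in> nodes1 n \<rightarrow>\<^sub>E UNIV. \<forall>(i, j)\<in>arcsA1 n.
     u i - u j + d (i, j) \<le> 1 - x (i, j)}"

definition P_DL :: "nat \<Rightarrow> (nat \<times> nat \<Rightarrow> real) \<Rightarrow> (nat \<times> nat \<Rightarrow> real) set" where
  "P_DL n d = {x \<in> P_AP n. \<exists>u \<in> nodes1 n \<rightarrow>\<^sub>E UNIV. \<forall>(i, j)\<in>arcsA1 n.
     u i - u j + x (i, j) + (1 - d (i, j) - d (j, i)) * x (j, i) \<le> 1 - d (i, j)}"

definition P_SCF :: "nat \<Rightarrow> (nat \<Rightarrow> real) \<Rightarrow> (nat \<times> nat \<Rightarrow> real) set" where
  "P_SCF n b = {x \<in> P_AP n. \<exists>f \<in> arcsA n \<rightarrow>\<^sub>E {0..}.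
     (\<forall>i\<in>nodes1 n. (\<Sum>a\<in>leaving n i. f a) - (\<Sum>a\<in>entering n i. f a) = - b i) \<and>
     (\<forall>a\<in>arcsA n. f a \<le> x a)}"

definition Cl :: "('p \<Rightarrow> 'x set) \<Rightarrow> 'p set \<Rightarrow> 'x set" where
  "Cl P Q = (\<Inter>p\<in>Q. P p)"

lemma cycles1D:
  assumes "C \<in> cycles1 n"
  shows "C \<subseteq> arcsA1 n" "finite C" "inj_on fst C" "inj_on snd C" "fst ` C = snd ` C" "card C \<ge> 2"
proof -
  let ?G = "complete_on (nodes1 n)"
  obtain p u where C: "C = set p" and w: "pre_digraph.awalk ?G u p u"
    and dist: "distinct (tl (pre_digraph.awalk_verts ?G u p))" and ne: "p \<noteq> []"
    using assms by (auto simp: cycles1_def pre_digraph.cycle_def)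
  have sub: "set p \<subseteq> arcsA1 n" and cas: "pcas u p u"
    using w by (auto simp: pre_digraph.awalk_def complete_on_def cas_with_proj_eq)
  have vs: "pawalk_verts a p = a # map snd p" "pawalk_verts a p = map fst p @ [b]"
    if "pcas a p b" for a b
    using that by (induction p arbitrary: a) auto
  have snd_d: "distinct (map snd p)"
    using dist vs[OF cas] by (simp add: complete_on_def awalk_verts_with_proj_eq)
  have ms: "mset (map fst p) = mset (map snd p)"
    using arg_cong[OF trans[OF vs(1)[OF cas, symmetric] vs(2)[OF cas]], of mset] by simp
  then have fst_d: "distinct (map fst p)"
    using snd_d by (metis mset_eq_imp_distinct_iff)
  show "C \<subseteq> arcsA1 n" "finite C" "inj_on fst C" "inj_on snd C"
    using sub snd_d fst_d C by (auto simp: distinct_map)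
  show eq: "fst ` C = snd ` C"
    using arg_cong[OF ms, of set_mset] C by simp
  obtain i j where ij: "(i, j) \<in> C" using ne C by (cases p) auto
  then have "j \<in> fst ` C" using eq by force
  then obtain l where jl: "(j, l) \<in> C" by auto
  have "i \<noteq> j" using ij sub C by (auto simp: arcs_between_def)
  then have "card {(i, j), (j, l)} = 2" by simp
  then show "card C \<ge> 2"
    using card_mono[of C "{(i, j), (j, l)}"] ij jl C by simp
qed

lemma D_set_subset_Dbar_set: "D_set n \<subseteq> Dbar_set n"
  by (force simp: D_set_def Dbar_set_def PiE_iff less_imp_le)

lemma V_MTZ_subset_Dbar_set: "V_MTZ n \<subseteq> Dbar_set n"
proof
  fix d assume "d \<in> V_MTZ n"
  then obtain k where d: "d = d_MTZ n k" by (auto simp: V_MTZ_def)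
  have "(\<Sum>a\<in>C. d a) \<le> 1" if C: "C \<in> cycles1 n" for C
  proof -
    note c = cycles1D[OF C]
    have "(\<Sum>a\<in>C. d a) = (\<Sum>a\<in>C. if fst a = k then 1 else 0)"
      using c(1) by (intro sum.cong) (auto simp: d d_MTZ_def)
    also have "\<dots> = (\<Sum>i\<in>fst ` C. if i = k then 1 else 0)"
      using c(3) by (simp add: sum.reindex)
    also have "\<dots> \<le> 1" using c(2) by simp
    finally show ?thesis .
  qed
  then show "d \<in> Dbar_set n"
    by (auto simp: Dbar_set_def d d_MTZ_def)
qed

end

theory Submission
  imports Defs
begin

text \<open>
  Summing \<open>u i - u j \<le> w (i, j)\<close> along a cycle cancels \<open>u\<close>, and by a shortest path argument the resulting
  inequalities on cycles are also sufficient for such a \<open>u\<close> to exist (\<open>potential_iff_cycles_nonneg\<close>).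
  Hence \<open>P_MTZ n d\<close> and \<open>P_DL n d\<close> are described inside the assignment polytope by one inequality per
  cycle, affine in \<open>d\<close>. As \<open>D_set n\<close> is dense in \<open>Dbar_set n\<close>, intersecting over \<open>D_set n\<close> yields the
  inequalities for all parameters in \<open>Dbar_set n\<close>, in particular for \<open>V_MTZ n\<close>.

  The inclusions follow by comparing inequalities. A flow has to bring the demand of \<open>S\<close> into \<open>S\<close>, so the
  closure of the flow formulation satisfies all subtour inequalities (\<open>Cl_SCF_subtour\<close>). The subtour
  inequality on the nodes of a cycle bounds the weight of both orientations of the cycle together, which
  dominates every DL inequality; dropping the reversed arcs from a DL inequality of \<open>V_MTZ n\<close> leaves
  \<open>sum x C \<le> card C - 1\<close>, and these inequalities are exactly the MTZ closure (\<open>Cl_MTZ_D_iff\<close>).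

  For four nodes the chain closes up, because the inequalities for cycles of length two already
  guarantee the required flows: a unit flow from node \<open>1\<close> to any other node can be written down
  explicitly (\<open>unit_flow_four_nodes\<close>).

  For the separations, a matrix prescribed on a node set \<open>S\<close> is completed to a point of the
  assignment polytope whose weight elsewhere is spread evenly over the remaining nodes
  (\<open>block_extension_in_P_AP\<close>). On a cycle the matrix has weights \<open>a\<close> forward and \<open>1 - a\<close> backward, with
  \<open>a = 2/3\<close> against the MTZ closure and \<open>a = 1/2\<close> against the closure over \<open>V_MTZ n\<close>, and the backward arcs
  left out by the inequality in question are deleted (\<open>cycle_violation_point\<close>). Against the DL closure the
  matrix is constant (\<open>DL_D_violation\<close>). Membership in the closures is then checked by simple
  bounds on the entries, as triangles are the worst cycles of length at least three.
\<close>

section \<open>Cycles of a complete digraph\<close>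

text \<open>
  The nodes that a closed walk visits after its start are the heads of its arcs, so a closed walk
  is a cycle exactly if these heads are distinct.
\<close>

lemma cycles1_iff:
  "C \<in> cycles1 n \<longleftrightarrow> (\<exists>u p. C = set p \<and> p \<noteq> [] \<and> set p \<subseteq> arcsA1 n \<and> pcas u p u \<and> distinct (map snd p))"
proof -
  have verts: "tl (pawalk_verts u p) = map snd p" if "pcas u p v" for u p v
  proof -
    have "pawalk_verts u p = u # map snd p"
      using that by (induction p arbitrary: u) auto
    then show ?thesis by simp
  qed
  have start: "u \<in> nodes1 n" if "pcas u p v" "p \<noteq> []" "set p \<subseteq> arcsA1 n" for u p v
    using that by (cases p) (auto simp: arcs_between_def)
  have eq: "pre_digraph.cycle (complete_on (nodes1 n)) p \<longleftrightarrow>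
      (\<exists>u. p \<noteq> [] \<and> set p \<subseteq> arcsA1 n \<and> pcas u p u \<and> distinct (map snd p))" for p
    unfolding pre_digraph.cycle_def pre_digraph.awalk_def complete_on_def
      cas_with_proj_eq awalk_verts_with_proj_eq with_proj_simps pair_pre_digraph.simps
    by (intro iffI; elim exE conjE) (metis verts start)+
  show ?thesis
    unfolding cycles1_def mem_Collect_eq eq by blast
qed

text \<open>
  Following the arcs from any node of a cycle visits all its nodes, so no proper part of a cycle is
  closed under successors. This is what distinguishes a cycle from a disjoint union of cycles.
\<close>

lemma cycle_fst_subset_closed:
  assumes C: "C \<in> cycles1 n" and closed: "\<And>i j. (i, j) \<in> C \<Longrightarrow> i \<in> T \<Longrightarrow> j \<in> T"
    and meet: "(i0, j0) \<in> C" "i0 \<in> T"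
  shows "fst ` C \<subseteq> T"
proof -
  obtain u p where p: "C = set p" "pcas u p u"
    using C by (auto simp: cycles1_iff)
  have "v \<in> T" if "pcas a q v" "(i0, j0) \<in> set q" "set q \<subseteq> C" for a q v
    using that
  proof (induction q arbitrary: a)
    case (Cons e q)
    have *: "y \<in> T" if "pcas b r y" "b \<in> T" "set r \<subseteq> C" for b r y
      using that closed by (induction r arbitrary: b) force+
    show ?case
    proof (cases "(i0, j0) = e")
      case True
      have "j0 \<in> T" using meet closed by blast
      then show ?thesis using True Cons.prems * by force
    next
      case False
      then show ?thesis using Cons by auto
    qed
  qed simp
  then have "u \<in> T" using p meet by blast
  moreover have "fst ` set q \<subseteq> T" if "pcas b q v" "b \<in> T" "set q \<subseteq> C" for b q v
    using that closed by (induction q arbitrary: b) force+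
  ultimately show ?thesis using p by blast
qed

lemma cycle_leaves:
  assumes C: "C \<in> cycles1 n" and "(i, j) \<in> C" "i \<in> T" "fst ` C - T \<noteq> {}"
  shows "\<exists>a b. (a, b) \<in> C \<and> a \<in> T \<and> b \<notin> T"
proof (rule ccontr)
  assume "\<not> ?thesis"
  then have "b \<in> T" if "(a, b) \<in> C" "a \<in> T" for a b
    using that by metis
  then have "fst ` C \<subseteq> T"
    using cycle_fst_subset_closed[OF C _ assms(2,3)] by metis
  then show False using assms(4) by blast
qed

text \<open>
  Sums of \<open>x (i, j) + x (j, i)\<close> over a cycle count each arc once, except on cycles of length two,
  where both orientations of the same pair occur. Most arguments below split along this line.
\<close>

lemma cycle_two_or_antiparallel_free:
  assumes C: "C \<in> cycles1 n"
  obtains (two) a b where "a \<noteq> b" "C = {(a, b), (b, a)}"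
    | (long) "card C \<ge> 3" "\<And>i j. (i, j) \<in> C \<Longrightarrow> (j, i) \<notin> C"
proof (cases "\<exists>a b. (a, b) \<in> C \<and> (b, a) \<in> C")
  case True
  note c = cycles1D[OF C]
  obtain a b where ab: "(a, b) \<in> C" "(b, a) \<in> C" using True by auto
  have uniq: "y = z" if "(x, y) \<in> C" "(x, z) \<in> C" for x y z
    using inj_onD[OF c(3)] that by fastforce
  have "fst ` C \<subseteq> {a, b}"
    using ab uniq by (intro cycle_fst_subset_closed[OF C _ ab(1)]) auto
  then have "e \<in> {(a, b), (b, a)}" if "e \<in> C" for e
    using that ab uniq[of a b "snd e"] uniq[of b a "snd e"] by (cases e) force
  then have "C = {(a, b), (b, a)}" using ab by blast
  moreover have "a \<noteq> b" using ab c(1) by (auto simp: arcs_between_def)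
  ultimately show ?thesis by (rule two[rotated])
next
  case False
  note c = cycles1D[OF C]
  have "card C \<noteq> 2"
  proof
    assume "card C = 2"
    then obtain e f where ef: "C = {e, f}" "e \<noteq> f" by (meson card_2_iff)
    have "{fst e, fst f} = {snd e, snd f}" using c(5) unfolding ef(1) by simp
    moreover have "fst e \<noteq> snd e" "fst f \<noteq> snd f" using c(1) unfolding ef(1) by (auto simp: arcs_between_def)
    ultimately have "f = (snd e, fst e)" by (auto simp: doubleton_eq_iff prod_eq_iff)
    then have "(fst e, snd e) \<in> C \<and> (snd e, fst e) \<in> C" unfolding ef(1) by simp
    then show False using False by blast
  qed
  with c(6) have "card C \<ge> 3" by simp
  then show ?thesis using False by (intro long) auto
qed

text \<open>
  Shortest paths are handled as lists of nodes; this turns such a list, closed up at its first node,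
  into an arc set in \<^term>\<open>cycles1 n\<close> of the same weight.
\<close>

lemma sum_list_closed_walk_cycle:
  assumes d: "distinct (i # xs)" and ne: "xs \<noteq> []" and sub: "set (i # xs) \<subseteq> nodes1 n"
  defines "p \<equiv> zip (i # xs @ [i]) (xs @ [i])"
  shows "set p \<in> cycles1 n" and "sum w (set p) = sum_list (map w p)"
proof -
  have cas: "pcas a (zip (a # l) l) (last (a # l))" for a l
    by (induction l arbitrary: a) auto
  have snd: "map snd (zip (a # l) l) = l" for a and l :: "nat list"
    by (induction l arbitrary: a) auto
  have dist: "distinct (map snd p)" unfolding p_def snd using d by auto
  have "set p \<subseteq> arcsA1 n"
  proof clarify
    fix a b assume ab: "(a, b) \<in> set p"
    have mem: "a \<in> set (i # xs)" "b \<in> set (i # xs)"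
      using set_zip_leftD[OF ab[unfolded p_def]] set_zip_rightD[OF ab[unfolded p_def]] by auto
    obtain m where m: "m < Suc (length xs)" "a = (i # xs @ [i]) ! m" "b = (xs @ [i]) ! m"
      using ab unfolding p_def by (auto simp: in_set_conv_nth)
    have "a \<noteq> b"
    proof (cases m)
      case 0
      then show ?thesis using m d ne by (cases xs) auto
    next
      case (Suc q)
      have "distinct (xs @ [i])" using d by auto
      then show ?thesis using m Suc nth_eq_iff_index_eq[of "xs @ [i]" q m] by auto
    qed
    then show "(a, b) \<in> arcsA1 n" using mem sub by (auto simp: arcs_between_def)
  qed
  moreover have "pcas i p i" using cas[of i "xs @ [i]"] by (simp add: p_def)
  moreover have "p \<noteq> []" by (simp add: p_def)
  ultimately show "set p \<in> cycles1 n" using dist unfolding cycles1_iff by blast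
  show "sum w (set p) = sum_list (map w p)"
    using dist by (simp add: distinct_map sum_list_distinct_conv_sum_set)
qed

lemma two_cycle_in_cycles1:
  assumes "a \<in> nodes1 n" "b \<in> nodes1 n" "a \<noteq> b"
  shows "{(a, b), (b, a)} \<in> cycles1 n"
  using sum_list_closed_walk_cycle(1)[of a "[b]" n] assms by (simp add: insert_commute)

lemma three_cycle_in_cycles1:
  assumes "a \<in> nodes1 n" "b \<in> nodes1 n" "c \<in> nodes1 n" "a \<noteq> b" "b \<noteq> c" "a \<noteq> c"
  shows "{(a, b), (b, c), (c, a)} \<in> cycles1 n"
  using sum_list_closed_walk_cycle(1)[of a "[b, c]" n] assms by simp

section \<open>Potentials\<close>

text \<open>
  Differences of potentials cancel along a cycle, so the condition on cycles is necessary. Conversely,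
  let \<open>u i\<close> be the least weight of a simple path starting in \<open>i\<close> (the empty path included).
  Prepending the arc \<open>ij\<close> to a best path from \<open>j\<close> gives a simple path from \<open>i\<close>, or else closes a
  cycle that can be cut off without increasing the weight; hence \<open>u i \<le> w (i, j) + u j\<close>.
\<close>

theorem potential_iff_cycles_nonneg:
  fixes w :: "nat \<times> nat \<Rightarrow> real"
  shows "(\<exists>u\<in>nodes1 n \<rightarrow>\<^sub>E UNIV. \<forall>(i, j)\<in>arcsA1 n. u i - u j \<le> w (i, j)) \<longleftrightarrow>
    (\<forall>C\<in>cycles1 n. 0 \<le> sum w C)"
proof (intro iffI ballI)
  fix C assume C: "C \<in> cycles1 n"
  assume "\<exists>u\<in>nodes1 n \<rightarrow>\<^sub>E UNIV. \<forall>(i, j)\<in>arcsA1 n. u i - u j \<le> w (i, j)"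
  then obtain u where u: "\<forall>(i, j)\<in>arcsA1 n. u i - u j \<le> w (i, j)" by blast
  note c = cycles1D[OF C]
  have "(\<Sum>a\<in>C. u (fst a) - u (snd a)) = sum u (fst ` C) - sum u (snd ` C)"
    using c(3,4) by (simp add: sum_subtractf sum.reindex)
  also have "\<dots> = 0" using c(5) by simp
  finally show "0 \<le> sum w C"
    using sum_mono[of C "\<lambda>a. u (fst a) - u (snd a)" w] u c(1) by fastforce
next
  assume nonneg: "\<forall>C\<in>cycles1 n. 0 \<le> sum w C"
  define pw where "pw i l = sum_list (map w (zip (i # l) l))" for i l
  define P where "P i = {l. set l \<subseteq> nodes1 n - {i} \<and> distinct l}" for i
  define u where "u = restrict (\<lambda>i. Min (pw i ` P i)) (nodes1 n)"
  have fin: "finite (pw i ` P i)" for i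
    unfolding P_def by (intro finite_imageI finite_subset_distinct) (simp add: nodes1_def nodes_def)
  have split: "pw j (xs @ i # ys) = pw j (xs @ [i]) + pw i ys" for j xs i ys
    by (induction xs arbitrary: j) (auto simp: pw_def)
  have "u i - u j \<le> w (i, j)" if ij: "(i, j) \<in> arcsA1 n" for i j
  proof -
    have ij': "i \<in> nodes1 n" "j \<in> nodes1 n" "i \<noteq> j" using ij by (auto simp: arcs_between_def)
    have "Min (pw j ` P j) \<in> pw j ` P j"
      using fin by (intro Min_in) (auto simp: P_def intro: exI[of _ "[]"])
    then obtain l where l: "l \<in> P j" "u j = pw j l" using ij' by (auto simp: u_def)
    have "\<exists>l'\<in>P i. pw i l' \<le> w (i, j) + pw j l"
    proof (cases "i \<in> set l")
      case False
      then have "j # l \<in> P i" using l ij' by (auto simp: P_def)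
      then show ?thesis by (force simp: pw_def)
    next
      case True
      (* The path already visits i: cut off the cycle that it closes with the arc (i, j). *)
      then obtain xs ys where s: "l = xs @ i # ys" by (meson split_list)
      have cyc: "distinct (i # j # xs)" "j # xs \<noteq> []" "set (i # j # xs) \<subseteq> nodes1 n"
        using l ij' s by (auto simp: P_def)
      have "sum_list (map w (zip (i # (j # xs) @ [i]) ((j # xs) @ [i]))) \<ge> 0"
        using nonneg sum_list_closed_walk_cycle(1)[OF cyc]
        unfolding sum_list_closed_walk_cycle(2)[OF cyc, symmetric] by blast
      then have "0 \<le> w (i, j) + pw j (xs @ [i])" by (simp add: pw_def)
      moreover have "ys \<in> P i" using l s by (auto simp: P_def)
      ultimately show ?thesis using split[of j xs i ys] s by (intro bexI[of _ ys]) auto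
    qed
    then obtain l' where l': "l' \<in> P i" "pw i l' \<le> w (i, j) + pw j l" by blast
    have "u i \<le> pw i l'" using ij' fin l' by (auto simp: u_def intro!: Min_le)
    then show ?thesis using l' l by simp
  qed
  then show "\<exists>u\<in>nodes1 n \<rightarrow>\<^sub>E UNIV. \<forall>(i, j)\<in>arcsA1 n. u i - u j \<le> w (i, j)"
    using PiE_restrict[of "\<lambda>i. Min (pw i ` P i)"]
    by (intro bexI[of _ u]) (auto simp del: restrict_apply, auto simp: u_def)
qed

section \<open>Cycle descriptions of the parametric polyhedra\<close>

lemma finite_nodes [simp]: "finite (nodes n)" "finite (nodes1 n)"
  by (simp_all add: nodes_def nodes1_def)

lemma arcs_between_Sigma: "arcs_between S = Sigma S (\<lambda>i. S - {i})"
  by (auto simp: arcs_between_def)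

lemma sum_arcs_between:
  assumes "finite S"
  shows "sum f (arcs_between S) = (\<Sum>i\<in>S. \<Sum>j\<in>S - {i}. f (i, j))"
  unfolding arcs_between_Sigma using assms by (subst sum.Sigma) auto

lemma sum_arcs_between_swap:
  assumes "finite S"
  shows "sum f (arcs_between S) = (\<Sum>i\<in>S. \<Sum>j\<in>S - {i}. f (j, i))"
proof -
  have "sum f (arcs_between S) = (\<Sum>(i, j)\<in>arcs_between S. f (j, i))"
    by (rule sum.reindex_bij_witness[of _ prod.swap prod.swap]) (auto simp: arcs_between_def)
  also have "\<dots> = (\<Sum>i\<in>S. \<Sum>j\<in>S - {i}. f (j, i))"
    using assms by (subst sum_arcs_between) auto
  finally show ?thesis .
qed

lemma P_AP_bounds:
  assumes "x \<in> P_AP n" "(i, j) \<in> arcsA n"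
  shows "0 \<le> x (i, j)" "x (i, j) \<le> 1"
  using assms PiE_mem[of x "arcsA n" "\<lambda>_. {0..1}"] by (auto simp: P_AP_def)

lemma arcsA1_subset: "arcsA1 n \<subseteq> arcsA n"
  by (auto simp: arcs_between_def nodes1_def)

lemma arcs_between_swap: "(i, j) \<in> arcs_between S \<longleftrightarrow> (j, i) \<in> arcs_between S"
  by (auto simp: arcs_between_def)

lemma P_MTZ_iff:
  "x \<in> P_MTZ n d \<longleftrightarrow> x \<in> P_AP n \<and> (\<forall>C\<in>cycles1 n. sum x C + sum d C \<le> card C)"
proof -
  have "(\<exists>u\<in>nodes1 n \<rightarrow>\<^sub>E UNIV. \<forall>(i, j)\<in>arcsA1 n. u i - u j + d (i, j) \<le> 1 - x (i, j))
    \<longleftrightarrow> (\<exists>u\<in>nodes1 n \<rightarrow>\<^sub>E UNIV. \<forall>(i, j)\<in>arcsA1 n. u i - u j \<le> 1 - x (i, j) - d (i, j))"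
    by (intro bex_cong refl ball_cong) (auto simp: algebra_simps)
  also have "\<dots> \<longleftrightarrow> (\<forall>C\<in>cycles1 n. 0 \<le> (\<Sum>a\<in>C. 1 - x a - d a))"
    by (rule potential_iff_cycles_nonneg)
  also have "\<dots> \<longleftrightarrow> (\<forall>C\<in>cycles1 n. sum x C + sum d C \<le> card C)"
    by (simp add: sum_subtractf sum.distrib algebra_simps)
  finally show ?thesis unfolding P_MTZ_def by blast
qed

text \<open>
  The arc \<open>ij\<close> contributes this to the left-hand side of the DL inequalities summed along a cycle, after
  the potentials have cancelled and \<open>d (i, j)\<close> has been moved to the left.
\<close>

definition dl_term :: "(nat \<times> nat \<Rightarrow> real) \<Rightarrow> (nat \<times> nat \<Rightarrow> real) \<Rightarrow> nat \<times> nat \<Rightarrow> real" where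
  "dl_term d x = (\<lambda>(i, j). x (i, j) + (1 - d (i, j) - d (j, i)) * x (j, i) + d (i, j))"

lemma P_DL_iff:
  "x \<in> P_DL n d \<longleftrightarrow> x \<in> P_AP n \<and> (\<forall>C\<in>cycles1 n. sum (dl_term d x) C \<le> card C)"
proof -
  have "(\<exists>u\<in>nodes1 n \<rightarrow>\<^sub>E UNIV. \<forall>(i, j)\<in>arcsA1 n.
      u i - u j + x (i, j) + (1 - d (i, j) - d (j, i)) * x (j, i) \<le> 1 - d (i, j))
    \<longleftrightarrow> (\<exists>u\<in>nodes1 n \<rightarrow>\<^sub>E UNIV. \<forall>(i, j)\<in>arcsA1 n. u i - u j \<le> 1 - dl_term d x (i, j))"
    by (intro bex_cong refl ball_cong) (auto simp: dl_term_def algebra_simps)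
  also have "\<dots> \<longleftrightarrow> (\<forall>C\<in>cycles1 n. 0 \<le> (\<Sum>a\<in>C. 1 - dl_term d x a))"
    by (rule potential_iff_cycles_nonneg)
  also have "\<dots> \<longleftrightarrow> (\<forall>C\<in>cycles1 n. sum (dl_term d x) C \<le> card C)"
    by (simp add: sum_subtractf)
  finally show ?thesis unfolding P_DL_def by blast
qed

section \<open>Passing to the closed parameter set\<close>

text \<open>
  Mixing in the constant vector \<open>1 / n\<close> moves a point of \<^term>\<open>Dbar_set n\<close> into \<^term>\<open>D_set n\<close>: it
  makes all entries positive, and the constant vector satisfies the cycle constraints because no cycle
  has more than \<open>n\<close> arcs. So \<^term>\<open>D_set n\<close> is dense in \<^term>\<open>Dbar_set n\<close>, and inequalities that are
  affine in the parameter pass from the former to the latter.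
\<close>

definition mix :: "nat \<Rightarrow> real \<Rightarrow> (nat \<times> nat \<Rightarrow> real) \<Rightarrow> nat \<times> nat \<Rightarrow> real" where
  "mix n e d = restrict (\<lambda>a. (1 - e) * d a + e * (1 / n)) (arcsA1 n)"

lemma card_cycle_le:
  assumes "C \<in> cycles1 n"
  shows "card C \<le> n"
proof -
  note c = cycles1D[OF assms]
  have "card C = card (fst ` C)" using c(3) by (simp add: card_image)
  also have "\<dots> \<le> card (nodes n)"
    using c(1) by (intro card_mono) (auto simp: arcs_between_def nodes1_def)
  finally show ?thesis by (simp add: nodes_def)
qed

lemma mix_in_D_set:
  assumes d: "d \<in> Dbar_set n" and e: "0 < e" "e < 1" and n: "0 < n"
  shows "mix n e d \<in> D_set n"
proof -
  have pos: "0 \<le> d a" if "a \<in> arcsA1 n" for a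
    using d that PiE_mem[of d "arcsA1 n" "\<lambda>_. {0..}"] by (auto simp: Dbar_set_def)
  have "sum (mix n e d) C \<le> 1" if C: "C \<in> cycles1 n" for C
  proof -
    have "sum (mix n e d) C = (\<Sum>a\<in>C. (1 - e) * d a + e * (1 / n))"
      using cycles1D(1)[OF C] by (intro sum.cong) (auto simp: mix_def)
    also have "\<dots> = (1 - e) * sum d C + e * (card C / n)"
      by (simp add: sum.distrib sum_distrib_left)
    also have "\<dots> \<le> (1 - e) * 1 + e * 1"
      using d C e n card_cycle_le[OF C] by (intro add_mono mult_left_mono) (auto simp: Dbar_set_def)
    finally show ?thesis by simp
  qed
  moreover have "0 < mix n e d a" if "a \<in> arcsA1 n" for a
    using pos[OF that] e n that by (simp add: mix_def add_nonneg_pos)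
  ultimately show ?thesis by (auto simp: D_set_def mix_def)
qed

lemma le_if_mixtures_le:
  fixes A B K :: real
  assumes "\<And>e. 0 < e \<Longrightarrow> e < 1 \<Longrightarrow> (1 - e) * A + e * B \<le> K"
  shows "A \<le> K"
proof (rule tendsto_upperbound)
  show "((\<lambda>e. (1 - e) * A + e * B) \<longlongrightarrow> A) (at_right 0)"
    by (auto intro!: tendsto_eq_intros)
  show "\<forall>\<^sub>F e in at_right 0. (1 - e) * A + e * B \<le> K"
    unfolding eventually_at_right_field using assms by (intro exI[of _ 1]) auto
qed simp

lemma Cl_MTZ_D_subset:
  assumes x: "x \<in> Cl (P_MTZ n) (D_set n)" and d: "d \<in> Dbar_set n" and n: "0 < n"
  shows "x \<in> P_MTZ n d"
  unfolding P_MTZ_iff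
proof (intro conjI ballI)
  have mem: "x \<in> P_MTZ n (mix n e d)" if "0 < e" "e < 1" for e
    using x mix_in_D_set[OF d that n] by (auto simp: Cl_def)
  show "x \<in> P_AP n" using mem[of "1/2"] by (simp add: P_MTZ_def)
  fix C assume C: "C \<in> cycles1 n"
  show "sum x C + sum d C \<le> card C"
  proof (rule le_if_mixtures_le)
    fix e :: real assume e: "0 < e" "e < 1"
    have "sum (mix n e d) C = (\<Sum>a\<in>C. (1 - e) * d a + e * (1 / n))"
      using cycles1D(1)[OF C] by (intro sum.cong) (auto simp: mix_def)
    also have "\<dots> = (1 - e) * sum d C + e * (card C / n)"
      by (simp add: sum.distrib sum_distrib_left)
    moreover have "sum x C + sum (mix n e d) C \<le> card C"
      using mem[OF e] C by (simp add: P_MTZ_iff)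
    ultimately show "(1 - e) * (sum x C + sum d C) + e * (sum x C + card C / n) \<le> card C"
      by (simp add: algebra_simps)
  qed
qed

text \<open>
  For fixed \<open>x\<close> the cycle inequality of \<open>P_DL\<close> is affine in \<open>d\<close>, since \<open>d\<close> occurs in it only linearly and is
  multiplied only by entries of \<open>x\<close>.
\<close>

lemma Cl_DL_D_subset:
  assumes x: "x \<in> Cl (P_DL n) (D_set n)" and d: "d \<in> Dbar_set n" and n: "0 < n"
  shows "x \<in> P_DL n d"
  unfolding P_DL_iff
proof (intro conjI ballI)
  have mem: "x \<in> P_DL n (mix n e d)" if "0 < e" "e < 1" for e
    using x mix_in_D_set[OF d that n] by (auto simp: Cl_def)
  show "x \<in> P_AP n" using mem[of "1/2"] by (simp add: P_DL_def)
  fix C assume C: "C \<in> cycles1 n"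
  show "sum (dl_term d x) C \<le> card C"
  proof (rule le_if_mixtures_le)
    fix e :: real assume e: "0 < e" "e < 1"
    have "dl_term (mix n e d) x a = (1 - e) * dl_term d x a + e * dl_term (\<lambda>_. 1 / n) x a" if "a \<in> C" for a
    proof -
      obtain i j where a: "a = (i, j)" by (cases a)
      have "(i, j) \<in> arcsA1 n" "(j, i) \<in> arcsA1 n"
        using that cycles1D(1)[OF C] a by (auto simp: arcs_between_def)
      then show ?thesis
        unfolding a by (simp add: dl_term_def mix_def algebra_simps)
    qed
    then have "sum (dl_term (mix n e d) x) C
        = (1 - e) * sum (dl_term d x) C + e * sum (dl_term (\<lambda>_. 1 / n) x) C"
      by (simp add: sum.distrib sum_distrib_left)
    moreover have "sum (dl_term (mix n e d) x) C \<le> card C"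
      using mem[OF e] C by (simp add: P_DL_iff)
    ultimately show "(1 - e) * sum (dl_term d x) C + e * sum (dl_term (\<lambda>_. 1 / n) x) C \<le> card C"
      by simp
  qed
qed

lemma d_MTZ_in_Dbar_set: "k \<in> nodes1 n \<Longrightarrow> d_MTZ n k \<in> Dbar_set n"
  using V_MTZ_subset_Dbar_set by (auto simp: V_MTZ_def)

lemma Cl_DL_D_subset_Cl_DL_V:
  assumes "0 < n"
  shows "Cl (P_DL n) (D_set n) \<subseteq> Cl (P_DL n) (V_MTZ n)"
  using Cl_DL_D_subset V_MTZ_subset_Dbar_set assms by (force simp: Cl_def)

lemma sum_d_MTZ_cycle:
  assumes C: "C \<in> cycles1 n" and k: "k \<in> fst ` C"
  shows "sum (d_MTZ n k) C = 1"
proof -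
  note c = cycles1D[OF C]
  have "sum (d_MTZ n k) C = (\<Sum>a\<in>C. if fst a = k then 1 else 0)"
    using c(1) by (intro sum.cong) (auto simp: d_MTZ_def)
  also have "\<dots> = (\<Sum>i\<in>fst ` C. if i = k then 1 else 0)"
    using c(3) by (simp add: sum.reindex)
  also have "\<dots> = 1" using c(2) k by simp
  finally show ?thesis .
qed

lemma cycle_fst_nodes:
  assumes "C \<in> cycles1 n"
  obtains k where "k \<in> fst ` C" "k \<in> nodes1 n"
proof -
  have "C \<noteq> {}" using cycles1D(6)[OF assms] by auto
  then show ?thesis using that cycles1D(1)[OF assms] by (force simp: arcs_between_def)
qed

text \<open>
  In \<open>sum x C + sum d C \<le> card C\<close> the strongest choice is \<open>sum d C = 1\<close>. It is attained in the closure of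
  \<^term>\<open>D_set n\<close> by \<^term>\<open>d_MTZ n k\<close> for any node \<open>k\<close> of the cycle.
\<close>

theorem Cl_MTZ_D_iff:
  assumes n: "2 \<le> n"
  shows "x \<in> Cl (P_MTZ n) (D_set n) \<longleftrightarrow>
    x \<in> P_AP n \<and> (\<forall>C\<in>cycles1 n. sum x C \<le> real (card C) - 1)"
proof (intro iffI conjI ballI; (elim conjE)?)
  assume x: "x \<in> Cl (P_MTZ n) (D_set n)"
  have "2 \<in> nodes1 n" using n by (simp add: nodes1_def nodes_def)
  from Cl_MTZ_D_subset[OF x d_MTZ_in_Dbar_set[OF this]] show "x \<in> P_AP n"
    using n by (simp add: P_MTZ_def)
  fix C assume C: "C \<in> cycles1 n"
  then obtain k where k: "k \<in> fst ` C" "k \<in> nodes1 n" using cycle_fst_nodes by blast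
  have "sum x C + sum (d_MTZ n k) C \<le> card C"
    using Cl_MTZ_D_subset[OF x d_MTZ_in_Dbar_set[OF k(2)]] n C by (simp add: P_MTZ_iff)
  then show "sum x C \<le> real (card C) - 1" by (simp add: sum_d_MTZ_cycle[OF C k(1)])
next
  assume x: "x \<in> P_AP n" "\<forall>C\<in>cycles1 n. sum x C \<le> real (card C) - 1"
  have "x \<in> P_MTZ n d" if d: "d \<in> D_set n" for d
    unfolding P_MTZ_iff
  proof (intro conjI ballI)
    fix C assume C: "C \<in> cycles1 n"
    then have "sum d C \<le> 1" using d by (simp add: D_set_def)
    then show "sum x C + sum d C \<le> card C" using x(2) C by fastforce
  qed fact
  then show "x \<in> Cl (P_MTZ n) (D_set n)" by (auto simp: Cl_def)
qed

text \<open>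
  For a node \<open>k\<close> of the cycle, the DL inequality of \<^term>\<open>d_MTZ n k\<close> is the inequality
  \<open>sum x C \<le> card C - 1\<close> strengthened by reversed arcs with coefficients in \<open>{0, 1}\<close>.
\<close>

lemma Cl_DL_V_subset_Cl_MTZ_D:
  assumes n: "2 \<le> n"
  shows "Cl (P_DL n) (V_MTZ n) \<subseteq> Cl (P_MTZ n) (D_set n)"
proof
  fix x assume "x \<in> Cl (P_DL n) (V_MTZ n)"
  then have x: "x \<in> P_DL n (d_MTZ n k)" if "k \<in> nodes1 n" for k
    using that by (auto simp: Cl_def V_MTZ_def)
  have "2 \<in> nodes1 n" using n by (simp add: nodes1_def nodes_def)
  from x[OF this] have AP: "x \<in> P_AP n" by (simp add: P_DL_def)
  have "sum x C \<le> real (card C) - 1" if C: "C \<in> cycles1 n" for C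
  proof -
    obtain k where k: "k \<in> fst ` C" "k \<in> nodes1 n" using C cycle_fst_nodes by blast
    have "(\<Sum>a\<in>C. x a + d_MTZ n k a) \<le> sum (dl_term (d_MTZ n k) x) C"
    proof (rule sum_mono)
      fix a assume "a \<in> C"
      then obtain i j where a: "a = (i, j)" and ij: "(i, j) \<in> arcsA1 n"
        using cycles1D(1)[OF C] by (cases a) auto
      then have "(j, i) \<in> arcsA n" using arcsA1_subset arcs_between_swap by blast
      then have "0 \<le> x (j, i)" using AP P_AP_bounds by blast
      moreover have "d_MTZ n k (i, j) + d_MTZ n k (j, i) \<le> 1"
        using ij by (auto simp: d_MTZ_def arcs_between_def)
      ultimately show "x a + d_MTZ n k a \<le> dl_term (d_MTZ n k) x a"
        by (simp add: a dl_term_def)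
    qed
    also have "\<dots> \<le> card C" using x[OF k(2)] C by (simp add: P_DL_iff)
    finally show ?thesis by (simp add: sum.distrib sum_d_MTZ_cycle[OF C k(1)])
  qed
  then show "x \<in> Cl (P_MTZ n) (D_set n)" using AP Cl_MTZ_D_iff[OF n] by blast
qed

section \<open>The single commodity flow closure and subtour inequalities\<close>

lemma sum_leaving:
  assumes "i \<in> nodes n"
  shows "sum f (leaving n i) = (\<Sum>j\<in>nodes n - {i}. f (i, j))"
  using assms
  by (intro sum.reindex_bij_witness[of _ "Pair i" snd])
     (auto simp: out_arcs_def complete_on_def arcs_between_def)

lemma sum_entering:
  assumes "i \<in> nodes n"
  shows "sum f (entering n i) = (\<Sum>j\<in>nodes n - {i}. f (j, i))"
  using assms
  by (intro sum.reindex_bij_witness[of _ "\<lambda>j. (j, i)" fst])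
     (auto simp: in_arcs_def complete_on_def arcs_between_def)

text \<open>
  The demand \<open>sum b S\<close> has to enter \<open>S\<close> through arcs whose total capacity is \<open>card S\<close> minus the weight of
  \<open>x\<close> inside \<open>S\<close>, by the assignment equations.
\<close>

lemma P_SCF_subtour:
  fixes x :: "nat \<times> nat \<Rightarrow> real" and b :: "nat \<Rightarrow> real"
  assumes x: "x \<in> P_SCF n b" and S: "S \<subseteq> nodes1 n"
  shows "sum x (arcs_between S) \<le> card S - sum b S"
proof -
  obtain f :: "nat \<times> nat \<Rightarrow> real" where f: "f \<in> arcsA n \<rightarrow>\<^sub>E {0..}"
    and bal: "\<And>i. i \<in> nodes1 n \<Longrightarrow> sum f (leaving n i) - sum f (entering n i) = - b i"
    and cap: "\<And>a. a \<in> arcsA n \<Longrightarrow> f a \<le> x a"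
    using x by (auto simp: P_SCF_def)
  have AP: "x \<in> P_AP n" using x by (simp add: P_SCF_def)
  have fS: "finite S" using finite_subset[OF S] by simp
  define T where "T = nodes n - S"
  have SN: "S \<subseteq> nodes n" using S by (auto simp: nodes1_def)
  have split: "(\<Sum>j\<in>nodes n - {i}. g j) = (\<Sum>j\<in>S - {i}. g j) + (\<Sum>j\<in>T. g j)"
    if "i \<in> S" for i and g :: "nat \<Rightarrow> real"
  proof -
    have "nodes n - {i} = (S - {i}) \<union> T" using SN that by (auto simp: T_def)
    then show ?thesis using fS by (simp add: sum.union_disjoint T_def Diff_Int_distrib2)
  qed
  have "- sum b S = (\<Sum>i\<in>S. sum f (leaving n i) - sum f (entering n i))"
    using bal S by (simp add: sum_negf[symmetric] subset_iff)
  also have "\<dots> = (\<Sum>i\<in>S. (\<Sum>j\<in>S - {i}. f (i, j)) + (\<Sum>j\<in>T. f (i, j))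
      - ((\<Sum>j\<in>S - {i}. f (j, i)) + (\<Sum>j\<in>T. f (j, i))))"
    using SN by (intro sum.cong refl) (simp add: subset_iff sum_leaving sum_entering split)
  also have "\<dots> = (\<Sum>i\<in>S. \<Sum>j\<in>T. f (i, j)) - (\<Sum>i\<in>S. \<Sum>j\<in>T. f (j, i))"
    using sum_arcs_between[OF fS, of f] sum_arcs_between_swap[OF fS, of f]
    by (simp add: sum_subtractf sum.distrib)
  finally have bS: "sum b S = (\<Sum>i\<in>S. \<Sum>j\<in>T. f (j, i)) - (\<Sum>i\<in>S. \<Sum>j\<in>T. f (i, j))" by simp
  have arc: "(i, j) \<in> arcsA n" "(j, i) \<in> arcsA n" if "i \<in> S" "j \<in> T" for i j
    using that SN by (auto simp: arcs_between_def T_def)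
  have "0 \<le> (\<Sum>i\<in>S. \<Sum>j\<in>T. f (i, j))"
    using f arc by (intro sum_nonneg) (auto dest: PiE_mem)
  then have "sum b S \<le> (\<Sum>i\<in>S. \<Sum>j\<in>T. f (j, i))" using bS by simp
  also have "\<dots> \<le> (\<Sum>i\<in>S. \<Sum>j\<in>T. x (j, i))"
    using arc cap by (intro sum_mono) auto
  also have "\<dots> = (\<Sum>i\<in>S. 1 - (\<Sum>j\<in>S - {i}. x (j, i)))"
  proof (rule sum.cong)
    fix i assume i: "i \<in> S"
    have "(\<Sum>j\<in>nodes n - {i}. x (j, i)) = 1" using AP i SN by (auto simp: P_AP_def)
    then show "(\<Sum>j\<in>T. x (j, i)) = 1 - (\<Sum>j\<in>S - {i}. x (j, i))" using split[OF i] by simp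
  qed simp
  also have "\<dots> = card S - sum x (arcs_between S)"
    by (simp add: sum_subtractf sum_arcs_between_swap[OF fS])
  finally show ?thesis by simp
qed

lemma B_set_concentrated:
  assumes n: "2 \<le> n" and k: "k \<in> nodes1 n" and e: "0 < e" "e < 1"
  shows "restrict (\<lambda>i. (if i = k then 1 - e else 0) + e / (real n - 1)) (nodes1 n) \<in> B_set n"
proof -
  have card: "real (card (nodes1 n)) = real n - 1"
    using n by (auto simp: nodes1_def nodes_def of_nat_diff)
  have "(\<Sum>i\<in>nodes1 n. (if i = k then 1 - e else 0) + e / (real n - 1)) = 1"
    using k n by (simp add: sum.distrib card)
  then show ?thesis using e n by (auto simp: B_set_def add_pos_pos)
qed

text \<open>
  Demands that are almost concentrated on a single node of \<open>S\<close> push \<open>sum b S\<close> towards \<open>1\<close>.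
\<close>

theorem Cl_SCF_subtour:
  assumes x: "x \<in> Cl (P_SCF n) (B_set n)" and n: "2 \<le> n"
    and S: "S \<subseteq> nodes1 n" "S \<noteq> {}"
  shows "sum x (arcs_between S) \<le> real (card S) - 1"
proof -
  obtain k where k: "k \<in> S" using S by blast
  have fS: "finite S" using finite_subset[OF S(1)] by simp
  have "sum x (arcs_between S) - card S + 1 \<le> 0"
  proof (rule le_if_mixtures_le)
    fix e :: real assume e: "0 < e" "e < 1"
    define b where "b = restrict (\<lambda>i. (if i = k then 1 - e else 0) + e / (real n - 1)) (nodes1 n)"
    have b: "b \<in> B_set n" unfolding b_def using B_set_concentrated[OF n _ e] k S by blast
    have "b i \<ge> 0" if "i \<in> S" for i
      using that S e n by (auto simp: b_def subset_iff)
    then have "b k \<le> sum b S" using k fS by (intro member_le_sum) auto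
    moreover have "1 - e \<le> b k" using k S e n by (auto simp: b_def subset_iff)
    moreover have "sum x (arcs_between S) \<le> card S - sum b S"
      using P_SCF_subtour[of x n b S] x b S by (auto simp: Cl_def)
    ultimately show "(1 - e) * (sum x (arcs_between S) - card S + 1)
        + e * (sum x (arcs_between S) - card S) \<le> 0"
      by (simp add: algebra_simps)
  qed
  then show ?thesis by simp
qed

lemma sum_both_directions_le:
  fixes x :: "nat \<times> nat \<Rightarrow> real"
  assumes C: "C \<in> cycles1 n" and free: "\<And>i j. (i, j) \<in> C \<Longrightarrow> (j, i) \<notin> C"
    and nonneg: "\<And>a. a \<in> arcs_between (fst ` C) \<Longrightarrow> 0 \<le> x a"
  shows "(\<Sum>a\<in>C. x a + x (prod.swap a)) \<le> sum x (arcs_between (fst ` C))"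
proof -
  note c = cycles1D[OF C]
  have sub: "C \<subseteq> arcs_between (fst ` C)"
    using c(1,5) by (force simp: arcs_between_def)
  have "(\<Sum>a\<in>C. x (prod.swap a)) = sum x (prod.swap ` C)"
    by (simp add: sum.reindex)
  then have "(\<Sum>a\<in>C. x a + x (prod.swap a)) = sum x (C \<union> prod.swap ` C)"
    using free c(2) by (subst sum.union_disjoint) (auto simp: sum.distrib)
  also have "\<dots> \<le> sum x (arcs_between (fst ` C))"
    using sub c(2) nonneg by (intro sum_mono2) (auto simp: arcs_between_Sigma)
  finally show ?thesis .
qed

lemma dl_term_two_cycle_le:
  assumes "x (a, b) + x (b, a) \<le> 1" "d (a, b) + d (b, a) \<le> 1" "a \<noteq> b"
  shows "sum (dl_term d x) {(a, b), (b, a)} \<le> 2"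
proof -
  define y D where "y = x (a, b) + x (b, a)" and "D = d (a, b) + d (b, a)"
  have "sum (dl_term d x) {(a, b), (b, a)} = y * (2 - D) + D"
    using assms(3) by (simp add: dl_term_def y_def D_def algebra_simps)
  also have "\<dots> \<le> 1 * (2 - D) + D"
    using assms by (intro add_right_mono mult_right_mono) (auto simp: y_def D_def)
  finally show ?thesis by simp
qed

lemma Dbar_nonneg: "d \<in> Dbar_set n \<Longrightarrow> a \<in> arcsA1 n \<Longrightarrow> 0 \<le> d a"
  using PiE_mem[of d "arcsA1 n" "\<lambda>_. {0..}"] by (auto simp: Dbar_set_def)

lemma dl_term_le:
  assumes x: "x \<in> P_AP n" and d: "d \<in> Dbar_set n" and ij: "(i, j) \<in> arcsA1 n"
  shows "dl_term d x (i, j) \<le> x (i, j) + x (j, i) + d (i, j) * (1 - x (j, i))"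
proof -
  have ji: "(j, i) \<in> arcsA1 n" using ij arcs_between_swap by blast
  have "0 \<le> d (j, i) * x (j, i)"
    using Dbar_nonneg[OF d ji] P_AP_bounds[OF x] ji arcsA1_subset by fastforce
  then show ?thesis by (simp add: dl_term_def algebra_simps)
qed

text \<open>
  A cycle of length at least three and its reversal consist of different arcs inside the node set \<open>S\<close> of
  the cycle. By the subtour inequality of \<open>S\<close> both orientations together have weight at most
  \<open>card C - 1\<close>, and \<open>sum d C \<le> 1\<close> accounts for the missing unit.
\<close>

lemma Cl_SCF_B_subset_Cl_DL_D:
  assumes n: "2 \<le> n"
  shows "Cl (P_SCF n) (B_set n) \<subseteq> Cl (P_DL n) (D_set n)"
proof
  fix x assume x: "x \<in> Cl (P_SCF n) (B_set n)"
  have "2 \<in> nodes1 n" using n by (simp add: nodes1_def nodes_def)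
  from B_set_concentrated[OF n this, of "1/2"] x have AP: "x \<in> P_AP n"
    by (auto simp: Cl_def P_SCF_def)
  have "x \<in> P_DL n d" if "d \<in> D_set n" for d
    unfolding P_DL_iff
  proof (intro conjI ballI)
    have d: "d \<in> Dbar_set n" using that D_set_subset_Dbar_set by blast
    fix C assume C: "C \<in> cycles1 n"
    note c = cycles1D[OF C]
    define S where "S = fst ` C"
    have S: "S \<subseteq> nodes1 n" "S \<noteq> {}" "C \<subseteq> arcs_between S" "card S = card C"
      using c(1,5,6) card_image[OF c(3)] by (auto simp: S_def arcs_between_def) force+
    have sub: "sum x (arcs_between S) \<le> real (card C) - 1"
      using Cl_SCF_subtour[OF x n S(1,2)] S(4) by simp
    have dC: "sum d C \<le> 1" using d C by (simp add: Dbar_set_def)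
    from C show "sum (dl_term d x) C \<le> card C"
    proof (cases rule: cycle_two_or_antiparallel_free)
      case (two a b)
      have "arcs_between S = {(a, b), (b, a)}" "card C = 2"
        using two by (auto simp: S_def arcs_between_def)
      then show ?thesis
        using dl_term_two_cycle_le[of x a b d] sub dC two by simp
    next
      case long
      have "(\<Sum>a\<in>C. x a + x (prod.swap a)) \<le> sum x (arcs_between S)"
        unfolding S_def
      proof (rule sum_both_directions_le[OF C long(2)])
        fix a assume "a \<in> arcs_between (fst ` C)"
        then have "a \<in> arcsA n" using S(1) by (auto simp: S_def arcs_between_def nodes1_def)
        then show "0 \<le> x a" using P_AP_bounds(1)[OF AP] by (cases a) blast
      qed
      then have y: "(\<Sum>a\<in>C. x a + x (prod.swap a)) \<le> real (card C) - 1"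
        using sub by simp
      have "sum (dl_term d x) C \<le> (\<Sum>a\<in>C. (x a + x (prod.swap a)) + d a)"
      proof (rule sum_mono)
        fix a assume "a \<in> C"
        then obtain i j where a: "a = (i, j)" and ij: "(i, j) \<in> arcsA1 n"
          using c(1) by (cases a) auto
        have "(j, i) \<in> arcsA n" using ij arcsA1_subset arcs_between_swap by blast
        then have "0 \<le> d (i, j) * x (j, i)"
          using Dbar_nonneg[OF d ij] P_AP_bounds(1)[OF AP] by simp
        then show "dl_term d x a \<le> (x a + x (prod.swap a)) + d a"
          using dl_term_le[OF AP d ij] by (simp add: a algebra_simps)
      qed
      then show ?thesis using y dC by (simp add: sum.distrib)
    qed
  qed fact
  then show "x \<in> Cl (P_DL n) (D_set n)" by (auto simp: Cl_def)
qed

section \<open>Four nodes\<close>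

text \<open>
  With nodes \<open>1, a, b, k\<close>, sending one unit from \<open>1\<close> to \<open>k\<close> saturates all arcs leaving \<open>1\<close> and all arcs
  entering \<open>k\<close>, as both families have total weight \<open>1\<close>. What \<open>a\<close> receives from \<open>1\<close> beyond \<open>x (a, k)\<close> must
  go through \<open>ab\<close>, and symmetrically for \<open>b\<close>. The arc \<open>ab\<close> is wide enough if
  \<open>x (1, a) + x (a, 1) \<le> 1\<close>, and by the assignment equations this sum equals that of the
  complementary pair, \<open>x (b, k) + x (k, b)\<close>.
\<close>

lemma unit_flow_four_nodes:
  assumes x: "x \<in> P_AP 4" and two: "\<And>i j. (i, j) \<in> arcsA1 4 \<Longrightarrow> x (i, j) + x (j, i) \<le> 1"
    and k: "k \<in> nodes1 4"
  shows "\<exists>g. (\<forall>e\<in>arcsA 4. 0 \<le> g e \<and> g e \<le> x e) \<and>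
    (\<forall>i\<in>nodes1 4. (\<Sum>j\<in>nodes 4 - {i}. g (i, j)) - (\<Sum>j\<in>nodes 4 - {i}. g (j, i))
      = (if i = k then - 1 else 0))"
proof -
  have N1: "nodes1 4 = {2, 3, 4}" by (auto simp: nodes1_def nodes_def)
  have "\<exists>a b. nodes1 4 = {a, b, k} \<and> a \<noteq> b \<and> a \<noteq> k \<and> b \<noteq> k \<and> a \<noteq> 1 \<and> b \<noteq> 1 \<and> k \<noteq> 1"
  proof -
    from k consider "k = 2" | "k = 3" | "k = 4" by (auto simp: N1)
    then show ?thesis
    proof cases
      case 1 then show ?thesis unfolding N1 by (intro exI[of _ 3] exI[of _ 4]) auto
    next
      case 2 then show ?thesis unfolding N1 by (intro exI[of _ 2] exI[of _ 4]) auto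
    next
      case 3 then show ?thesis unfolding N1 by (intro exI[of _ 2] exI[of _ 3]) auto
    qed
  qed
  then obtain a b where ab: "nodes1 4 = {a, b, k}"
    and ne: "a \<noteq> b" "a \<noteq> k" "b \<noteq> k" "a \<noteq> 1" "b \<noteq> 1" "k \<noteq> 1" by blast
  have N: "nodes 4 = {1, a, b, k}"
  proof -
    have "nodes 4 = insert 1 (nodes1 4)" by (auto simp: nodes1_def nodes_def)
    then show ?thesis by (simp only: ab)
  qed
  have minus: "nodes 4 - {1} = {a, b, k}" "nodes 4 - {a} = {1, b, k}"
      "nodes 4 - {b} = {1, a, k}" "nodes 4 - {k} = {1, a, b}"
    using ne unfolding N by auto
  have row: "(\<Sum>j\<in>nodes 4 - {i}. x (i, j)) = 1" and col: "(\<Sum>j\<in>nodes 4 - {i}. x (j, i)) = 1"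
    if "i \<in> nodes 4" for i
    using x that unfolding P_AP_def by blast+
  have rows: "x (i, 1) + x (i, j) + x (i, l) = 1" "x (1, i) + x (j, i) + x (l, i) = 1"
    if "nodes 4 - {i} = {1, j, l}" "i \<in> nodes 4" "1 \<noteq> j" "1 \<noteq> l" "j \<noteq> l" for i j l
    using row[OF that(2)] col[OF that(2)] that(3-) unfolding that(1) by auto
  have one: "x (1, a) + x (1, b) + x (1, k) = 1" "x (a, 1) + x (b, 1) + x (k, 1) = 1"
    using row[of 1] col[of 1] ne unfolding minus(1) by (auto simp: N)
  have nn: "0 \<le> x (i, j)" if "i \<in> {1, a, b, k}" "j \<in> {1, a, b, k}" "i \<noteq> j" for i j
    using P_AP_bounds(1)[OF x] that by (auto simp: arcs_between_def N)
  have pair: "x (a, k) + x (k, a) \<le> 1" "x (b, k) + x (k, b) \<le> 1"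
    using two ab ne by (auto simp: arcs_between_def)
  have mem: "a \<in> nodes 4" "b \<in> nodes 4" "k \<in> nodes 4" and ne': "1 \<noteq> a" "1 \<noteq> b" "1 \<noteq> k"
    using ne unfolding N by simp_all
  define g where "g = (\<lambda>(i, j). if j = 1 \<or> i = k then 0 else if i = 1 \<or> j = k then x (i, j)
      else max 0 (x (1, i) - x (i, k)))"
  have eqs': "x (a, 1) + x (a, b) + x (a, k) = 1" "x (1, a) + x (b, a) + x (k, a) = 1"
      "x (b, 1) + x (b, a) + x (b, k) = 1" "x (1, b) + x (a, b) + x (k, b) = 1"
      "x (k, 1) + x (k, a) + x (k, b) = 1" "x (1, k) + x (a, k) + x (b, k) = 1"
    using rows[OF minus(2) mem(1) ne'(2,3) ne(3)] rows[OF minus(3) mem(2) ne'(1,3) ne(2)]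
      rows[OF minus(4) mem(3) ne'(1,2) ne(1)] by simp_all
  have n12: "0 \<le> x (a, b)" "0 \<le> x (b, a)" "0 \<le> x (1, a)" "0 \<le> x (1, b)" "0 \<le> x (1, k)"
      "0 \<le> x (a, k)" "0 \<le> x (b, k)" "0 \<le> x (k, a)" "0 \<le> x (k, b)"
      "0 \<le> x (a, 1)" "0 \<le> x (b, 1)" "0 \<le> x (k, 1)"
    using nn ne by auto
  have cap: "x (1, a) - x (a, k) \<le> x (a, b)" "x (1, b) - x (b, k) \<le> x (b, a)"
    using eqs' one pair by linarith+
  have anti: "x (1, b) - x (b, k) = - (x (1, a) - x (a, k))"
    using eqs' one by linarith
  have "\<forall>e\<in>arcsA 4. 0 \<le> g e \<and> g e \<le> x e"
    unfolding arcs_between_def N g_def using n12 cap ne by auto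
  moreover have "(\<Sum>j\<in>nodes 4 - {i}. g (i, j)) - (\<Sum>j\<in>nodes 4 - {i}. g (j, i))
      = (if i = k then - 1 else 0)" if "i \<in> nodes1 4" for i
  proof -
    from that consider "i = a" | "i = b" | "i = k" using ab by auto
    then show ?thesis
    proof cases
      case 1
      then show ?thesis using ne anti unfolding 1 minus(2) by (simp add: g_def max_def)
    next
      case 2
      then show ?thesis using ne anti unfolding 2 minus(3) by (simp add: g_def max_def)
    next
      case 3
      then show ?thesis using ne eqs'(6) unfolding 3 minus(4) by (simp add: g_def)
    qed
  qed
  ultimately show ?thesis by blast
qed

text \<open>
  Every demand vector in \<open>B_set 4\<close> is a convex combination of unit demands, and flows within the capacities
  \<open>x\<close> can be combined accordingly.
\<close>

lemma Cl_MTZ_D_four_subset_Cl_SCF_B: "Cl (P_MTZ 4) (D_set 4) \<subseteq> Cl (P_SCF 4) (B_set 4)"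
proof
  fix x assume "x \<in> Cl (P_MTZ 4) (D_set 4)"
  then have x: "x \<in> P_AP 4" and cyc: "\<And>C. C \<in> cycles1 4 \<Longrightarrow> sum x C \<le> real (card C) - 1"
    by (auto simp: Cl_MTZ_D_iff)
  have two: "x (i, j) + x (j, i) \<le> 1" if "(i, j) \<in> arcsA1 4" for i j
    using cyc[OF two_cycle_in_cycles1[of i 4 j]] that by (auto simp: arcs_between_def)
  obtain g where g: "\<And>k e. k \<in> nodes1 4 \<Longrightarrow> e \<in> arcsA 4 \<Longrightarrow> 0 \<le> g k e \<and> g k e \<le> x e"
    and bal: "\<And>k i. k \<in> nodes1 4 \<Longrightarrow> i \<in> nodes1 4 \<Longrightarrow>
      (\<Sum>j\<in>nodes 4 - {i}. g k (i, j)) - (\<Sum>j\<in>nodes 4 - {i}. g k (j, i)) = (if i = k then - 1 else 0)"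
    using unit_flow_four_nodes[OF x two] by metis
  have "x \<in> P_SCF 4 b" if b: "b \<in> B_set 4" for b
  proof -
    have bpos: "0 \<le> b i" if "i \<in> nodes1 4" for i
      using b that PiE_mem[of b "nodes1 4" "\<lambda>_. {0<..}"] by (auto simp: B_set_def intro: less_imp_le)
    have bsum: "sum b (nodes1 4) = 1" using b by (simp add: B_set_def)
    define f where "f = restrict (\<lambda>e. \<Sum>k\<in>nodes1 4. b k * g k e) (arcsA 4)"
    have f_nonneg: "0 \<le> f e" if "e \<in> arcsA 4" for e
      using that g[OF _ that] bpos by (auto simp: f_def intro!: sum_nonneg mult_nonneg_nonneg)
    have f_cap: "f e \<le> x e" if "e \<in> arcsA 4" for e
    proof -
      have "f e \<le> (\<Sum>k\<in>nodes1 4. b k * x e)"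
        using that g[OF _ that] bpos by (auto simp: f_def intro!: sum_mono mult_left_mono)
      also have "\<dots> = x e" using bsum by (simp add: sum_distrib_right[symmetric])
      finally show ?thesis .
    qed
    have f_bal: "sum f (leaving 4 i) - sum f (entering 4 i) = - b i" if i: "i \<in> nodes1 4" for i
    proof -
      have iN: "i \<in> nodes 4" using i by (simp add: nodes1_def)
      have "sum f (leaving 4 i) - sum f (entering 4 i)
          = (\<Sum>j\<in>nodes 4 - {i}. \<Sum>k\<in>nodes1 4. b k * g k (i, j))
          - (\<Sum>j\<in>nodes 4 - {i}. \<Sum>k\<in>nodes1 4. b k * g k (j, i))"
        unfolding sum_leaving[OF iN] sum_entering[OF iN] using iN
        by (intro arg_cong2[where f = minus] sum.cong) (auto simp: f_def arcs_between_def)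
      also have "\<dots> = (\<Sum>k\<in>nodes1 4. b k * ((\<Sum>j\<in>nodes 4 - {i}. g k (i, j)) - (\<Sum>j\<in>nodes 4 - {i}. g k (j, i))))"
        by (subst (1 2) sum.swap) (simp add: sum_distrib_left sum_subtractf right_diff_distrib)
      also have "\<dots> = (\<Sum>k\<in>nodes1 4. if k = i then - b k else 0)"
        using bal i by (intro sum.cong) auto
      also have "\<dots> = - b i" using i by simp
      finally show ?thesis .
    qed
    have "f \<in> arcsA 4 \<rightarrow>\<^sub>E {0..}" using f_nonneg by (auto simp: f_def)
    then show ?thesis using x f_cap f_bal unfolding P_SCF_def by blast
  qed
  then show "x \<in> Cl (P_SCF 4) (B_set 4)" by (auto simp: Cl_def)
qed

section \<open>Extending a matrix on a node set to a point of the assignment polytope\<close>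

definition row_deficit :: "nat set \<Rightarrow> (nat \<times> nat \<Rightarrow> real) \<Rightarrow> nat \<Rightarrow> real" where
  "row_deficit S z i = 1 - (\<Sum>j\<in>S - {i}. z (i, j))"

definition col_deficit :: "nat set \<Rightarrow> (nat \<times> nat \<Rightarrow> real) \<Rightarrow> nat \<Rightarrow> real" where
  "col_deficit S z j = 1 - (\<Sum>i\<in>S - {j}. z (i, j))"

text \<open>
  The counterexamples are prescribed on a node set \<open>S\<close> by a matrix \<open>z\<close> and
  completed outside of \<open>S\<close> to a point of the assignment polytope. What the rows of
  \<open>z\<close> lack is sent to node \<open>1\<close>; what the columns lack is spread evenly
  over arcs from the set \<open>W\<close> of nodes other than \<open>1\<close> outside
  \<open>S\<close>. Node \<open>1\<close> sends \<open>1 / r\<close> to each of the \<open>r\<close>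
  nodes of \<open>W\<close>, and the arcs inside \<open>W\<close> get weight \<open>1 / r\<close> as
  well. Then arcs from \<open>S\<close> to \<open>W\<close> carry nothing, and those from
  \<open>W\<close> to \<open>S\<close> and inside \<open>W\<close> at most \<open>1 / r\<close>.
\<close>

definition block_extension :: "nat \<Rightarrow> nat set \<Rightarrow> (nat \<times> nat \<Rightarrow> real) \<Rightarrow> nat \<times> nat \<Rightarrow> real" where
  "block_extension n S z = (let r = real (card (nodes1 n - S)) in
    restrict (\<lambda>(i, j).
      if i \<in> S then (if j \<in> S then z (i, j) else if j = 1 then row_deficit S z i else 0)
      else if i = 1 then (if j \<in> S then 0 else 1 / r)
      else (if j \<in> S then col_deficit S z j / r
            else if j = 1 then (1 - sum (row_deficit S z) S) / r else 1 / r)) (arcsA n))"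

lemma block_extension_A1:
  assumes "(i, j) \<in> arcsA1 n"
  shows "block_extension n S z (i, j) =
    (if i \<in> S then if j \<in> S then z (i, j) else 0
     else if j \<in> S then col_deficit S z j / card (nodes1 n - S) else 1 / card (nodes1 n - S))"
proof -
  have "i \<noteq> 1" "j \<noteq> 1" "(i, j) \<in> arcsA n"
    using assms by (auto simp: arcs_between_def nodes1_def)
  then show ?thesis by (simp add: block_extension_def Let_def)
qed

text \<open>
  The upper bound \<open>1\<close> on the entries follows from nonnegativity and the row sums.
\<close>

lemma P_AP_I:
  assumes ext: "x \<in> extensional (arcsA n)" and nonneg: "\<And>a. a \<in> arcsA n \<Longrightarrow> 0 \<le> x a"
    and row: "\<And>i. i \<in> nodes n \<Longrightarrow> (\<Sum>j\<in>nodes n - {i}. x (i, j)) = 1"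
    and col: "\<And>i. i \<in> nodes n \<Longrightarrow> (\<Sum>j\<in>nodes n - {i}. x (j, i)) = 1"
  shows "x \<in> P_AP n"
proof -
  have "x a \<le> 1" if a: "a \<in> arcsA n" for a
  proof -
    obtain i j where ij: "a = (i, j)" "i \<in> nodes n" "j \<in> nodes n - {i}"
      using a by (auto simp: arcs_between_def)
    have "x (i, j) \<le> (\<Sum>j\<in>nodes n - {i}. x (i, j))"
      using ij nonneg by (intro member_le_sum) (auto simp: arcs_between_def)
    then show ?thesis using row ij by simp
  qed
  then have "x \<in> arcsA n \<rightarrow>\<^sub>E {0..1}"
    using nonneg ext by (auto simp: PiE_def)
  then show ?thesis using row col by (simp add: P_AP_def)
qed

text \<open>
  The nodes of \<open>S\<close> send as much to node \<open>1\<close> as they receive from \<open>W\<close>, because the row sums and the column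
  sums of \<open>z\<close> have the same total. The last hypothesis says that this common amount is at most \<open>1\<close>, the
  throughput of node \<open>1\<close>.
\<close>

theorem block_extension_in_P_AP:
  assumes n: "0 < n" and S: "S \<subseteq> nodes1 n" "nodes1 n - S \<noteq> {}"
    and z: "\<And>a. a \<in> arcs_between S \<Longrightarrow> 0 \<le> z a"
    and row: "\<And>i. i \<in> S \<Longrightarrow> 0 \<le> row_deficit S z i"
    and col: "\<And>i. i \<in> S \<Longrightarrow> 0 \<le> col_deficit S z i"
    and total: "real (card S) - 1 \<le> sum z (arcs_between S)"
  shows "block_extension n S z \<in> P_AP n"
proof (rule P_AP_I)
  let ?x = "block_extension n S z"
  define W where "W = nodes1 n - S"
  define r where "r = real (card W)"
  define \<delta> where "\<delta> = sum (row_deficit S z) S"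
  have fS: "finite S" using finite_subset[OF S(1)] by simp
  have fW: "finite W" by (simp add: W_def)
  have r: "r \<ge> 1" using S(2) fW by (simp add: r_def W_def Suc_le_eq card_gt_0_iff)
  have d: "\<delta> = real (card S) - sum z (arcs_between S)"
    by (simp add: \<delta>_def row_deficit_def sum_subtractf sum_arcs_between[OF fS])
  have dcol: "\<delta> = sum (col_deficit S z) S"
    by (simp add: d col_deficit_def sum_subtractf sum_arcs_between_swap[OF fS])
  have d1: "\<delta> \<le> 1" using total d by simp
  have split: "(\<Sum>j\<in>nodes n - {i}. g j) = (if i = 1 then 0 else g 1) + (\<Sum>j\<in>S - {i}. g j) + (\<Sum>j\<in>W - {i}. g j)"
    if "i \<in> nodes n" for i and g :: "nat \<Rightarrow> real"
  proof -
    have "nodes n - {i} = ({1} - {i}) \<union> ((S - {i}) \<union> (W - {i}))"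
      using S(1) n by (auto simp: W_def nodes1_def nodes_def)
    then have "(\<Sum>j\<in>nodes n - {i}. g j) = sum g ({1} - {i}) + sum g ((S - {i}) \<union> (W - {i}))"
      using fS fW S(1) by (simp, subst sum.union_disjoint) (auto simp: W_def nodes1_def)
    also have "sum g ((S - {i}) \<union> (W - {i})) = sum g (S - {i}) + sum g (W - {i})"
      using fS fW by (intro sum.union_disjoint) (auto simp: W_def)
    finally show ?thesis by simp
  qed
  have val: "?x (i, j) = (if i \<in> S then (if j \<in> S then z (i, j) else if j = 1 then row_deficit S z i else 0)
      else if i = 1 then (if j \<in> S then 0 else 1 / r)
      else (if j \<in> S then col_deficit S z j / r
            else if j = 1 then (1 - \<delta>) / r else 1 / r))" if "i \<in> nodes n" "j \<in> nodes n" "i \<noteq> j" for i j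
    using that by (simp add: block_extension_def Let_def r_def W_def \<delta>_def arcs_between_def)
  show "?x \<in> extensional (arcsA n)" by (simp add: block_extension_def Let_def)
  show "0 \<le> ?x a" if "a \<in> arcsA n" for a
  proof -
    obtain i j where a: "a = (i, j)" "i \<in> nodes n" "j \<in> nodes n" "i \<noteq> j"
      using \<open>a \<in> arcsA n\<close> by (auto simp: arcs_between_def)
    then show ?thesis
      using z row col r d1 by (simp add: val arcs_between_def)
  qed
  have SN: "S \<subseteq> nodes n" "1 \<notin> S" "W \<subseteq> nodes n" "1 \<notin> W" "S \<inter> W = {}" "1 \<in> nodes n"
    using S n by (auto simp: nodes1_def W_def nodes_def)
  have ne1: "j \<noteq> 1" if "j \<in> S \<or> j \<in> W" for j using that SN by auto
  have inN: "j \<in> nodes n" if "j \<in> S \<or> j \<in> W" for j using that SN by auto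
  have WS: "j \<notin> S" if "j \<in> W" for j using that SN by auto
  have vals:
    "j \<in> S \<Longrightarrow> ?x (1, j) = 0" "j \<in> W \<Longrightarrow> ?x (1, j) = 1 / r"
    "i \<in> S \<Longrightarrow> j \<in> S \<Longrightarrow> i \<noteq> j \<Longrightarrow> ?x (i, j) = z (i, j)" "i \<in> S \<Longrightarrow> j \<in> W \<Longrightarrow> ?x (i, j) = 0"
    "i \<in> S \<Longrightarrow> ?x (i, 1) = row_deficit S z i" "i \<in> W \<Longrightarrow> ?x (i, 1) = (1 - \<delta>) / r"
    "i \<in> W \<Longrightarrow> j \<in> S \<Longrightarrow> ?x (i, j) = col_deficit S z j / r"
    "i \<in> W \<Longrightarrow> j \<in> W \<Longrightarrow> i \<noteq> j \<Longrightarrow> ?x (i, j) = 1 / r" for i j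
    using val[of i j] val[of 1 j] val[of i 1] ne1[of i] ne1[of j] inN[of i] inN[of j] WS SN(2,6)
    by metis+
  have Wconst: "(\<Sum>j\<in>W - {i}. 1 / r) = (r - 1) / r" if "i \<in> W" for i
    using that fW r by (simp add: r_def card_Diff_singleton of_nat_diff)
  have const: "(\<Sum>j\<in>W. c / r) = c" for c using r by (simp add: r_def)
  have other: "S - {i} = S" if "i \<notin> S" for i using that by blast
  have otherW: "W - {i} = W" if "i \<notin> W" for i using that by blast
  fix i assume i: "i \<in> nodes n"
  then consider "i = 1" | "i \<in> S" | "i \<in> W" by (auto simp: W_def nodes1_def)
  note cases = this
  from cases show "(\<Sum>j\<in>nodes n - {i}. ?x (i, j)) = 1"
  proof cases
    case 1
    have "(\<Sum>j\<in>S - {1}. ?x (1, j)) = 0" by (intro sum.neutral ballI vals(1)) simp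
    moreover have "(\<Sum>j\<in>W - {1}. ?x (1, j)) = (\<Sum>j\<in>W. 1 / r)"
      using SN(4) by (intro sum.cong vals(2)) auto
    ultimately show ?thesis using split[OF SN(6), of "\<lambda>j. ?x (1, j)"] const[of 1] unfolding 1 by simp
  next
    case 2
    have "(\<Sum>j\<in>S - {i}. ?x (i, j)) = (\<Sum>j\<in>S - {i}. z (i, j))"
      using 2 by (intro sum.cong vals(3)) auto
    moreover have "(\<Sum>j\<in>W - {i}. ?x (i, j)) = 0"
      using 2 by (intro sum.neutral ballI vals(4)) auto
    ultimately show ?thesis
      using split[OF i, of "\<lambda>j. ?x (i, j)"] vals(5)[OF 2] ne1[of i] 2 by (simp add: row_deficit_def)
  next
    case 3
    then have "(\<Sum>j\<in>S - {i}. ?x (i, j)) = (\<Sum>j\<in>S. col_deficit S z j / r)"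
      unfolding other[OF WS[OF 3]] by (intro sum.cong vals(7)) auto
    also have "\<dots> = \<delta> / r" by (simp add: dcol sum_divide_distrib)
    finally have "(\<Sum>j\<in>S - {i}. ?x (i, j)) = \<delta> / r" .
    moreover have "(\<Sum>j\<in>W - {i}. ?x (i, j)) = (\<Sum>j\<in>W - {i}. 1 / r)"
      using 3 by (intro sum.cong vals(8)) auto
    moreover have "(1 - \<delta>) / r + \<delta> / r + (r - 1) / r = 1" using r by (simp add: field_simps)
    ultimately show ?thesis
      using split[OF i, of "\<lambda>j. ?x (i, j)"] vals(6)[OF 3] ne1[of i] 3 Wconst[OF 3] r by simp
  qed
  from cases show "(\<Sum>j\<in>nodes n - {i}. ?x (j, i)) = 1"
  proof cases
    case 1
    have "(\<Sum>j\<in>S - {1}. ?x (j, 1)) = \<delta>"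
      unfolding \<delta>_def other[OF SN(2)] by (intro sum.cong vals(5)) auto
    moreover have "(\<Sum>j\<in>W - {1}. ?x (j, 1)) = (\<Sum>j\<in>W. (1 - \<delta>) / r)"
      unfolding otherW[OF SN(4)] by (intro sum.cong vals(6)) auto
    ultimately show ?thesis
      using split[OF SN(6), of "\<lambda>j. ?x (j, 1)"] const[of "1 - \<delta>"] unfolding 1 by simp
  next
    case 2
    have "i \<notin> W" using 2 WS by blast
    have "(\<Sum>j\<in>S - {i}. ?x (j, i)) = (\<Sum>j\<in>S - {i}. z (j, i))"
      using 2 by (intro sum.cong vals(3)) auto
    moreover have "(\<Sum>j\<in>W - {i}. ?x (j, i)) = (\<Sum>j\<in>W. col_deficit S z i / r)"
      unfolding otherW[OF \<open>i \<notin> W\<close>] using 2 by (intro sum.cong vals(7)) auto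
    ultimately show ?thesis
      using split[OF i, of "\<lambda>j. ?x (j, i)"] vals(1)[OF 2] ne1[of i] 2 const[of "col_deficit S z i"]
      by (simp add: col_deficit_def)
  next
    case 3
    have "(\<Sum>j\<in>S - {i}. ?x (j, i)) = 0"
      using 3 by (intro sum.neutral ballI vals(4)) auto
    moreover have "(\<Sum>j\<in>W - {i}. ?x (j, i)) = (\<Sum>j\<in>W - {i}. 1 / r)"
      using 3 by (intro sum.cong vals(8)) auto
    moreover have "1 / r + (r - 1) / r = 1" using r by (simp add: field_simps)
    ultimately show ?thesis
      using split[OF i, of "\<lambda>j. ?x (j, i)"] vals(2)[OF 3] ne1[of i] 3 Wconst[OF 3] r by simp
  qed
qed

section \<open>Membership criteria\<close>

text \<open>
  On a cycle of length \<open>m \<ge> 3\<close>, entries of at most \<open>2/3\<close> add up to at most \<open>2 * m / 3 \<le> m - 1\<close>.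
\<close>

lemma in_Cl_MTZ_D_if_small:
  assumes n: "2 \<le> n" and x: "x \<in> P_AP n"
    and small: "\<And>i j. (i, j) \<in> arcsA1 n \<Longrightarrow> x (i, j) \<le> 2/3 \<and> x (i, j) + x (j, i) \<le> 1"
  shows "x \<in> Cl (P_MTZ n) (D_set n)"
proof -
  have "sum x C \<le> real (card C) - 1" if C: "C \<in> cycles1 n" for C
    using C
  proof (cases rule: cycle_two_or_antiparallel_free)
    case (two a b)
    then have "(a, b) \<in> arcsA1 n" using cycles1D(1)[OF C] by simp
    then show ?thesis using small two by fastforce
  next
    case long
    have "sum x C \<le> (\<Sum>a\<in>C. 2/3)"
      using small cycles1D(1)[OF C] by (intro sum_mono) fastforce
    then show ?thesis using long(1) by simp
  qed
  then show ?thesis using x Cl_MTZ_D_iff[OF n] by blast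
qed

text \<open>
  For \<^term>\<open>d_MTZ n k\<close> the DL inequalities read \<open>u k - u j + x (k, j) \<le> 0\<close> on arcs leaving \<open>k\<close>,
  \<open>u i - u k + x (i, k) \<le> 1\<close> on arcs entering \<open>k\<close>, and \<open>u i - u j + x (i, j) + x (j, i) \<le> 1\<close> elsewhere.
  Lowering the potential of \<open>k\<close> alone by \<open>1/2\<close> satisfies all of them.
\<close>

lemma in_Cl_DL_V_if_at_most_half:
  assumes x: "x \<in> P_AP n" and half: "\<And>i j. (i, j) \<in> arcsA1 n \<Longrightarrow> x (i, j) \<le> 1/2"
  shows "x \<in> Cl (P_DL n) (V_MTZ n)"
proof -
  have "x \<in> P_DL n (d_MTZ n k)" if "k \<in> nodes1 n" for k
  proof -
    define u where "u = restrict (\<lambda>i. if i = k then - 1/2 else 0 :: real) (nodes1 n)"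
    have "u i - u j + x (i, j) + (1 - d_MTZ n k (i, j) - d_MTZ n k (j, i)) * x (j, i)
        \<le> 1 - d_MTZ n k (i, j)" if ij: "(i, j) \<in> arcsA1 n" for i j
    proof -
      have ji: "(j, i) \<in> arcsA1 n" using ij arcs_between_swap by blast
      have "i \<in> nodes1 n" "j \<in> nodes1 n" "i \<noteq> j" using ij by (auto simp: arcs_between_def)
      then show ?thesis using half[OF ij] half[OF ji] ij ji by (auto simp: u_def d_MTZ_def)
    qed
    moreover have "u \<in> nodes1 n \<rightarrow>\<^sub>E UNIV" by (simp add: u_def)
    ultimately show ?thesis using x unfolding P_DL_def by blast
  qed
  then show ?thesis by (auto simp: Cl_def V_MTZ_def)
qed

section \<open>Points violating the cycle inequalities\<close>

lemma sum_if_unique_le: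
  assumes "0 \<le> (a::real)" "finite F" "\<And>j j'. P j \<Longrightarrow> P j' \<Longrightarrow> j = j'"
  shows "(\<Sum>j\<in>F. if P j then a else 0) \<le> a"
proof (cases "\<exists>j\<in>F. P j")
  case True
  then obtain j0 where j0: "j0 \<in> F" "P j0" by blast
  have "(\<Sum>j\<in>F. if P j then a else 0) = (\<Sum>j\<in>F. if j = j0 then a else 0)"
    using j0 assms(3) by (intro sum.cong) auto
  then show ?thesis using assms(2) j0 by simp
next
  case False
  then have "(\<Sum>j\<in>F. if P j then a else 0) = 0" by (intro sum.neutral) auto
  then show ?thesis using assms(1) by simp
qed

lemma card_nodes1: "card (nodes1 n) = n - 1"
  by (cases n) (auto simp: nodes1_def nodes_def)

text \<open>
  Weight \<open>a\<close> on the cycle and \<open>1 - a\<close> on its reversal makes all row and column sums inside the cycle equal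
  to \<open>1\<close>. Deleting the reversals of the arcs in \<open>E\<close> opens the cycle to the remaining nodes at a cost of
  \<open>(1 - a) * card E < 1\<close>, so the weight inside the cycle still exceeds \<open>card C - 1\<close>. In both applications
  below the deleted arcs are exactly the ones that the inequality to be violated does not count.
\<close>

theorem cycle_violation_point:
  fixes a :: real
  assumes C: "C \<in> cycles1 n" and card: "3 \<le> card C" "card C \<le> n - 2"
    and E: "E \<subseteq> C" "(1 - a) * card E < 1" and a: "1/2 \<le> a" "a \<le> 1"
  obtains x where "x \<in> P_AP n"
    "\<And>i j. (i, j) \<in> arcsA1 n \<Longrightarrow> x (i, j) \<le> a \<and> x (i, j) + x (j, i) \<le> 1"
    "\<And>i j. (i, j) \<in> E \<Longrightarrow> x (j, i) = 0"
    "(\<Sum>(i, j)\<in>C. x (i, j) + x (j, i)) > real (card C) - 1"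
proof -
  note c = cycles1D[OF C]
  define S where "S = fst ` C"
  define r where "r = real (card (nodes1 n - S))"
  define z where "z = (\<lambda>(i, j). if (i, j) \<in> C then a else if (j, i) \<in> C \<and> (j, i) \<notin> E then 1 - a else 0)"
  define x where "x = block_extension n S z"
  have cS: "card S = card C" using card_image[OF c(3)] by (simp add: S_def)
  have fS: "finite S" using c(2) by (simp add: S_def)
  have S: "S \<subseteq> nodes1 n" using c(1) by (auto simp: S_def arcs_between_def)
  have W: "nodes1 n - S \<noteq> {}"
  proof
    assume "nodes1 n - S = {}"
    then have "card (nodes1 n) \<le> card S" using fS by (intro card_mono) auto
    then show False using cS card by (simp add: card_nodes1)
  qed
  have r: "1 \<le> r" using W by (simp add: r_def Suc_le_eq card_gt_0_iff)
  have free: "(j, i) \<notin> C" if "(i, j) \<in> C" for i j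
    using C
  proof (cases rule: cycle_two_or_antiparallel_free)
    case (two a b) then show ?thesis using card by simp
  next
    case long then show ?thesis using that by blast
  qed
  have uniq_out: "j = j'" if "(i, j) \<in> C" "(i, j') \<in> C" for i j j'
    using inj_onD[OF c(3) _ that] by simp
  have uniq_in: "i = i'" if "(i, j) \<in> C" "(i', j) \<in> C" for i i' j
    using inj_onD[OF c(4) _ that] by simp
  have z_nonneg: "0 \<le> z e" for e using a by (auto simp: z_def split: prod.splits)
  have z_le: "z (i, j) \<le> (if (i, j) \<in> C then a else 0) + (if (j, i) \<in> C then 1 - a else 0)" for i j
    using a by (auto simp: z_def)
  have row: "0 \<le> row_deficit S z i" for i
  proof -
    have "(\<Sum>j\<in>S - {i}. z (i, j)) \<le>
        (\<Sum>j\<in>S - {i}. if (i, j) \<in> C then a else 0) + (\<Sum>j\<in>S - {i}. if (j, i) \<in> C then 1 - a else 0)"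
      unfolding sum.distrib[symmetric] by (intro sum_mono z_le)
    also have "\<dots> \<le> a + (1 - a)"
      using a fS uniq_out uniq_in by (intro add_mono sum_if_unique_le) auto
    finally show ?thesis by (simp add: row_deficit_def)
  qed
  have col: "0 \<le> col_deficit S z j" for j
  proof -
    have "(\<Sum>i\<in>S - {j}. z (i, j)) \<le>
        (\<Sum>i\<in>S - {j}. if (i, j) \<in> C then a else 0) + (\<Sum>i\<in>S - {j}. if (j, i) \<in> C then 1 - a else 0)"
      unfolding sum.distrib[symmetric] by (intro sum_mono z_le)
    also have "\<dots> \<le> a + (1 - a)"
      using a fS uniq_out uniq_in by (intro add_mono sum_if_unique_le) auto
    finally show ?thesis by (simp add: col_deficit_def)
  qed
  have col_le: "col_deficit S z j \<le> 1 - a" if j: "j \<in> S" for j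
  proof -
    have "j \<in> snd ` C" using j c(5) by (simp add: S_def)
    then obtain i where ij: "(i, j) \<in> C" by auto
    then have "i \<in> S - {j}" using c(1) by (force simp: S_def arcs_between_def)
    then have "z (i, j) \<le> (\<Sum>i\<in>S - {j}. z (i, j))"
      using fS z_nonneg by (intro member_le_sum) auto
    then show ?thesis using ij by (simp add: col_deficit_def z_def)
  qed
  have "(\<Sum>e\<in>C. z e + z (prod.swap e)) = (\<Sum>e\<in>C. 1 - (if e \<in> E then 1 - a else 0))"
    using free by (intro sum.cong) (auto simp: z_def)
  also have "\<dots> = card C - (1 - a) * card E"
    using E c(2) by (simp add: sum_subtractf sum.If_cases Int_absorb1)
  finally have zC: "(\<Sum>e\<in>C. z e + z (prod.swap e)) > real (card C) - 1" using E(2) by simp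
  have "real (card S) - 1 \<le> sum z (arcs_between S)"
    using zC sum_both_directions_le[OF C free, of z] z_nonneg cS unfolding S_def by fastforce
  then have x: "x \<in> P_AP n"
    unfolding x_def using card row col z_nonneg by (intro block_extension_in_P_AP S W) auto
  have val: "x (i, j) = (if i \<in> S then if j \<in> S then z (i, j) else 0
      else if j \<in> S then col_deficit S z j / r else 1 / r)" if "(i, j) \<in> arcsA1 n" for i j
    using block_extension_A1[OF that] by (simp add: x_def r_def)
  have "x (i, j) \<le> a \<and> x (i, j) + x (j, i) \<le> 1" if ij: "(i, j) \<in> arcsA1 n" for i j
  proof -
    have ji: "(j, i) \<in> arcsA1 n" using ij arcs_between_swap by blast
    have ij': "i \<in> nodes1 n" "j \<in> nodes1 n" "i \<noteq> j" using ij by (auto simp: arcs_between_def)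
    have z1: "z (i, j) \<le> a" "z (i, j) + z (j, i) \<le> 1"
      using a free by (auto simp: z_def)
    have cr: "0 \<le> col_deficit S z l / r" "col_deficit S z l / r \<le> 1 - a" if "l \<in> S" for l
    proof -
      have "col_deficit S z l / r \<le> col_deficit S z l / 1"
        using r col by (intro divide_left_mono) auto
      then show "col_deficit S z l / r \<le> 1 - a" using col_le[OF that] by simp
      show "0 \<le> col_deficit S z l / r" using col r by simp
    qed
    have W2: "1 / r \<le> 1 / 2" if "i \<notin> S" "j \<notin> S"
    proof -
      have "card {i, j} \<le> card (nodes1 n - S)" using that ij' by (intro card_mono) auto
      then have "2 \<le> r" using ij'(3) by (simp add: r_def)
      then show ?thesis by simp
    qed
    show ?thesis
      using z1 cr[of i] cr[of j] W2 a by (auto simp: val[OF ij] val[OF ji])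
  qed
  moreover have xz: "x e = z e" "x (prod.swap e) = z (prod.swap e)" if e: "e \<in> C" for e
  proof -
    obtain i j where ij: "e = (i, j)" by (cases e)
    have "i \<in> fst ` C" "j \<in> snd ` C" using e ij by force+
    then have S2: "i \<in> S" "j \<in> S" using c(5) by (simp_all add: S_def)
    have "(i, j) \<in> arcsA1 n" "(j, i) \<in> arcsA1 n" using e ij c(1) by (auto simp: arcs_between_def)
    then show "x e = z e" "x (prod.swap e) = z (prod.swap e)" using S2 by (auto simp: ij val)
  qed
  moreover have "x (j, i) = 0" if "(i, j) \<in> E" for i j
  proof -
    have "(i, j) \<in> C" using that E(1) by blast
    then show ?thesis using xz(2)[of "(i, j)"] free that by (auto simp: z_def)
  qed
  moreover have "(\<Sum>(i, j)\<in>C. x (i, j) + x (j, i)) > real (card C) - 1"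
  proof -
    have "(\<Sum>(i, j)\<in>C. x (i, j) + x (j, i)) = (\<Sum>e\<in>C. z e + z (prod.swap e))"
    proof (rule sum.cong)
      fix e assume e: "e \<in> C"
      show "(case e of (i, j) \<Rightarrow> x (i, j) + x (j, i)) = z e + z (prod.swap e)"
        using xz[OF e] by (cases e) simp
    qed simp
    then show ?thesis using zC by simp
  qed
  ultimately show ?thesis using that x by blast
qed

lemma cycle_neighbours:
  assumes C: "C \<in> cycles1 n" and k: "k \<in> Field C"
  shows "(k, cycle_succ C k) \<in> C" "(cycle_pred C k, k) \<in> C"
proof -
  note c = cycles1D[OF C]
  have f: "k \<in> fst ` C" "k \<in> snd ` C" using k c(5) by (auto simp: Field_def Domain_fst Range_snd)
  obtain j i where ji: "(k, j) \<in> C" "(i, k) \<in> C" using f by auto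
  have "j' = j" if "(k, j') \<in> C" for j'
    using inj_onD[OF c(3) _ that ji(1)] by simp
  then show "(k, cycle_succ C k) \<in> C"
    unfolding cycle_succ_def by (rule theI[where P = "\<lambda>j. (k, j) \<in> C", OF ji(1)])
  have "i' = i" if "(i', k) \<in> C" for i'
    using inj_onD[OF c(4) _ that ji(2)] by simp
  then show "(cycle_pred C k, k) \<in> C"
    unfolding cycle_pred_def by (rule theI[where P = "\<lambda>i. (i, k) \<in> C", OF ji(2)])
qed

text \<open>
  The inequality omits the reversals of the two arcs at \<open>k\<close>. With \<open>a = 2/3\<close>, deleting them costs
  \<open>2 * (1/3) < 1\<close>, and \<open>2/3\<close> is also the largest weight for which all cycles, including triangles, satisfy
  the inequalities that describe the MTZ closure.
\<close>

theorem MTZ_violation: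
  assumes C: "C \<in> cycles1 n" and card: "3 \<le> card C" "card C \<le> n - 2" and k: "k \<in> Field C"
  shows "\<exists>x\<in>Cl (P_MTZ n) (D_set n).
    \<not> (\<Sum>(i, j)\<in>C. x (i, j) + x (j, i)) - x (cycle_succ C k, k) - x (k, cycle_pred C k)
      \<le> real (card C) - 1"
proof -
  note c = cycles1D[OF C]
  define E where "E = {e \<in> C. fst e = k} \<union> {e \<in> C. snd e = k}"
  have "card {e \<in> C. fst e = k} \<le> card {k}" "card {e \<in> C. snd e = k} \<le> card {k}"
    using c(3,4) by (intro card_inj_on_le[of fst] card_inj_on_le[of snd]; auto simp: inj_on_def)+
  then have "card E \<le> 2"
    unfolding E_def using card_Un_le[of "{e \<in> C. fst e = k}" "{e \<in> C. snd e = k}"] by simp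
  then have cE: "(1 - 2/3) * real (card E) < 1" by simp
  have E: "E \<subseteq> C" by (auto simp: E_def)
  obtain x where x: "x \<in> P_AP n"
    "\<And>i j. (i, j) \<in> arcsA1 n \<Longrightarrow> x (i, j) \<le> 2/3 \<and> x (i, j) + x (j, i) \<le> 1"
    "\<And>i j. (i, j) \<in> E \<Longrightarrow> x (j, i) = 0"
    "(\<Sum>(i, j)\<in>C. x (i, j) + x (j, i)) > real (card C) - 1"
    by (rule cycle_violation_point[OF C card E cE]) (auto simp: field_simps)
  have "x \<in> Cl (P_MTZ n) (D_set n)"
    using card x(1,2) by (intro in_Cl_MTZ_D_if_small) auto
  moreover have "x (cycle_succ C k, k) = 0" "x (k, cycle_pred C k) = 0"
    using cycle_neighbours[OF C k] by (auto intro!: x(3) simp: E_def)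
  ultimately show ?thesis using x(4) by force
qed

text \<open>
  Only one reversed arc is omitted here, so \<open>a = 1/2\<close> suffices, and entries up to \<open>1/2\<close> are harmless for
  the DL inequalities with parameters in \<^term>\<open>V_MTZ n\<close>.
\<close>

theorem DL_V_violation:
  assumes C: "C \<in> cycles1 n" and card: "3 \<le> card C" "card C \<le> n - 2" and kl: "(k, l) \<in> C"
  shows "\<exists>x\<in>Cl (P_DL n) (V_MTZ n).
    \<not> (\<Sum>(i, j)\<in>C. x (i, j) + x (j, i)) - x (l, k) \<le> real (card C) - 1"
proof -
  obtain x where x: "x \<in> P_AP n"
    "\<And>i j. (i, j) \<in> arcsA1 n \<Longrightarrow> x (i, j) \<le> 1/2 \<and> x (i, j) + x (j, i) \<le> 1"
    "\<And>i j. (i, j) \<in> {(k, l)} \<Longrightarrow> x (j, i) = 0"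
    "(\<Sum>(i, j)\<in>C. x (i, j) + x (j, i)) > real (card C) - 1"
    by (rule cycle_violation_point[OF C card, of "{(k, l)}" "1/2"]) (use kl in auto)
  have "x \<in> Cl (P_DL n) (V_MTZ n)"
    using x(1,2) by (intro in_Cl_DL_V_if_at_most_half) auto
  then show ?thesis using x(3)[of k l] x(4) by force
qed

section \<open>A point violating a subtour inequality\<close>

text \<open>
  Take the same weight \<open>c\<close> on all arcs inside \<open>S\<close>, where \<open>card S = s\<close>. The subtour inequality is violated
  if \<open>s * c > 1\<close>, the row sums allow \<open>(s - 1) * c \<le> 1\<close>, and the DL inequalities of triangles inside \<open>S\<close> need
  \<open>c \<le> 2/5\<close>; the value \<open>c = 2 / (2 * s - 1)\<close> meets all three for \<open>s \<ge> 3\<close>, the last one with equality for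
  \<open>s = 3\<close>. A cycle that enters and leaves \<open>S\<close> uses two arcs between \<open>S\<close> and \<open>W\<close> of small weight, and a
  cycle of length at least three inside \<open>W\<close> has entries of at most \<open>1/3\<close>.
\<close>

theorem DL_D_violation:
  assumes S: "S \<subseteq> nodes1 n" and card: "3 \<le> card S" "card S \<le> n - 2"
  shows "\<exists>x\<in>Cl (P_DL n) (D_set n). \<not> sum x (arcs_between S) \<le> real (card S) - 1"
proof -
  define s where "s = real (card S)"
  define c where "c = 2 / (2 * s - 1)"
  define r where "r = real (card (nodes1 n - S))"
  define x where "x = block_extension n S (\<lambda>_. c)"
  have fS: "finite S" using finite_subset[OF S] by simp
  have s: "3 \<le> s" using card by (simp add: s_def)
  have c: "0 < c" "c \<le> 2/5" using s by (auto simp: c_def field_simps)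
  have W: "nodes1 n - S \<noteq> {}"
  proof
    assume "nodes1 n - S = {}"
    then have "card (nodes1 n) \<le> card S" using fS by (intro card_mono) auto
    then show False using card by (simp add: card_nodes1)
  qed
  have r: "1 \<le> r" using W by (simp add: r_def Suc_le_eq card_gt_0_iff)
  have cm: "real (card (S - {i})) = s - 1" if "i \<in> S" for i
    using that fS s by (simp add: s_def card_Diff_singleton of_nat_diff)
  have def_eq: "1 - (s - 1) * c = 1 / (2 * s - 1)" using s by (simp add: c_def field_simps)
  have row: "row_deficit S (\<lambda>_. c) i = 1 / (2 * s - 1)" if "i \<in> S" for i
    unfolding row_deficit_def sum_constant cm[OF that] by (rule def_eq)
  have col: "col_deficit S (\<lambda>_. c) i = 1 / (2 * s - 1)" if "i \<in> S" for i
    unfolding col_deficit_def sum_constant cm[OF that] by (rule def_eq)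
  have small: "0 \<le> 1 / (2 * s - 1)" "1 / (2 * s - 1) \<le> 1/5" using s by (auto simp: field_simps)
  have "sum (\<lambda>_. c) (arcs_between S) = (\<Sum>i\<in>S. (s - 1) * c)"
    unfolding sum_arcs_between[OF fS] by (intro sum.cong refl) (simp only: sum_constant cm)
  also have "\<dots> = (s - 1) * (2 * s / (2 * s - 1))" by (simp add: s_def c_def)
  finally have total: "sum (\<lambda>_. c) (arcs_between S) = (s - 1) * (2 * s / (2 * s - 1))" .
  moreover have "(s - 1) * 1 < (s - 1) * (2 * s / (2 * s - 1))"
    using s by (intro mult_strict_left_mono) (auto simp: field_simps)
  ultimately have violated: "s - 1 < sum (\<lambda>_. c) (arcs_between S)" by simp
  have x: "x \<in> P_AP n"
    unfolding x_def using card S W row col small c violated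
    by (intro block_extension_in_P_AP) (auto simp: s_def)
  have val: "x (i, j) = (if i \<in> S then if j \<in> S then c else 0
      else if j \<in> S then 1 / (2 * s - 1) / r else 1 / r)" if "(i, j) \<in> arcsA1 n" for i j
    using block_extension_A1[OF that, of S "\<lambda>_. c"] col by (simp add: x_def r_def)
  have "sum x (arcs_between S) = sum (\<lambda>_. c) (arcs_between S)"
  proof (rule sum.cong)
    fix e assume e: "e \<in> arcs_between S"
    then have "e \<in> arcsA1 n" using S by (auto simp: arcs_between_def)
    with e show "x e = c" using val[of "fst e" "snd e"] by (auto simp: arcs_between_def)
  qed simp
  then have "\<not> sum x (arcs_between S) \<le> real (card S) - 1" using violated by (simp add: s_def)
  moreover have "x \<in> Cl (P_DL n) (D_set n)"
  proof -
    define y where "y = (\<lambda>(i, j). x (i, j) + x (j, i))"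
    have inside: "y (i, j) = 2 * c" if "(i, j) \<in> arcsA1 n" "i \<in> S" "j \<in> S" for i j
      using that val[of i j] val[of j i] arcs_between_swap[of i j] by (simp add: y_def)
    have outside: "y (i, j) = 2 / r" if "(i, j) \<in> arcsA1 n" "i \<notin> S" "j \<notin> S" for i j
      using that val[of i j] val[of j i] arcs_between_swap[of i j] by (simp add: y_def)
    have crossing: "y (i, j) \<le> 1/5" if "(i, j) \<in> arcsA1 n" "i \<in> S \<longleftrightarrow> j \<notin> S" for i j
    proof -
      have "1 / (2 * s - 1) / r \<le> 1 / (2 * s - 1) / 1"
        using r small by (intro divide_left_mono) auto
      then show ?thesis
        using that val[of i j] val[of j i] arcs_between_swap[of i j] small by (auto simp: y_def)
    qed
    have y_le_1: "y (i, j) \<le> 1" if ij: "(i, j) \<in> arcsA1 n" for i j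
    proof -
      have "y (i, j) \<le> 1" if "i \<notin> S" "j \<notin> S"
      proof -
        have "card {i, j} \<le> card (nodes1 n - S)"
          using that ij by (intro card_mono) (auto simp: arcs_between_def)
        then have "2 \<le> r" using ij by (simp add: r_def arcs_between_def)
        then show ?thesis by (simp add: outside[OF ij that])
      qed
      then show ?thesis using inside[OF ij] crossing[OF ij] c by linarith
    qed
    have "x \<in> P_DL n d" if "d \<in> D_set n" for d
      unfolding P_DL_iff
    proof (intro conjI ballI)
      have d: "d \<in> Dbar_set n" using that D_set_subset_Dbar_set by blast
      fix C assume C: "C \<in> cycles1 n"
      note cy = cycles1D[OF C]
      have dC: "sum d C \<le> 1" using d C by (simp add: Dbar_set_def)
      from C show "sum (dl_term d x) C \<le> card C"
      proof (cases rule: cycle_two_or_antiparallel_free)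
        case (two a b)
        then have "(a, b) \<in> arcsA1 n" using cy(1) by simp
        then have "x (a, b) + x (b, a) \<le> 1" using y_le_1 by (simp add: y_def)
        then show ?thesis
          using dl_term_two_cycle_le[of x a b d] dC two by simp
      next
        case long
        have bound: "sum (dl_term d x) C \<le> sum y C + (\<Sum>e\<in>C. d e * (1 - x (prod.swap e)))"
          unfolding sum.distrib[symmetric]
        proof (rule sum_mono)
          fix e assume "e \<in> C"
          then obtain i j where "e = (i, j)" "(i, j) \<in> arcsA1 n" using cy(1) by (cases e) auto
          then show "dl_term d x e \<le> y e + d e * (1 - x (prod.swap e))"
            using dl_term_le[OF x d] by (simp add: y_def)
        qed
        have weaker: "(\<Sum>e\<in>C. d e * (1 - x (prod.swap e))) \<le> 1"
        proof -
          have "(\<Sum>e\<in>C. d e * (1 - x (prod.swap e))) \<le> sum d C"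
          proof (rule sum_mono)
            fix e assume "e \<in> C"
            then obtain i j where e: "e = (i, j)" "(i, j) \<in> arcsA1 n" using cy(1) by (cases e) auto
            then have "(j, i) \<in> arcsA n" using arcsA1_subset arcs_between_swap by blast
            then have "0 \<le> d e * x (j, i)"
              using P_AP_bounds(1)[OF x] Dbar_nonneg[OF d e(2)] e by simp
            then show "d e * (1 - x (prod.swap e)) \<le> d e" using e by (simp add: algebra_simps)
          qed
          then show ?thesis using dC by simp
        qed
        have arcC: "(i, j) \<in> arcsA1 n" if "(i, j) \<in> C" for i j using that cy(1) by blast
        have sndC: "j \<in> fst ` C" if "(i, j) \<in> C" for i j using that cy(5) by force
        consider "fst ` C \<subseteq> S" | "fst ` C \<inter> S = {}" | "fst ` C \<inter> S \<noteq> {}" "fst ` C - S \<noteq> {}" by blast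
        then show ?thesis
        proof cases
          case 1
          have inS: "i \<in> S" "j \<in> S" if "(i, j) \<in> C" for i j
            using that 1 sndC by force+
          (* The coarse bound on the parameter terms is too weak here: the factor 1 - c is needed,
             since 2 * c may exceed 2/3. *)
          have "sum y C = (\<Sum>e\<in>C. 2 * c)"
            using inS arcC inside by (intro sum.cong) auto
          moreover have "(\<Sum>e\<in>C. d e * (1 - x (prod.swap e))) = (\<Sum>e\<in>C. d e * (1 - c))"
          proof (rule sum.cong)
            fix e assume e: "e \<in> C"
            obtain i j where ij: "e = (i, j)" by (cases e)
            have "(j, i) \<in> arcsA1 n" using arcC e ij arcs_between_swap by blast
            then show "d e * (1 - x (prod.swap e)) = d e * (1 - c)"
              using inS e ij by (simp add: val)
          qed simp
          moreover have "(\<Sum>e\<in>C. d e * (1 - c)) \<le> 1 * (1 - c)"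
            unfolding sum_distrib_right[symmetric] using dC c by (intro mult_right_mono) auto
          moreover have "3 * (1 - 2 * c) \<le> card C * (1 - 2 * c)"
            using long(1) c by (intro mult_right_mono) auto
          ultimately show ?thesis using bound c(2) by (simp add: algebra_simps)
        next
          case 2
          have notS: "i \<notin> S" "j \<notin> S" if "(i, j) \<in> C" for i j
            using that 2 sndC by force+
          have "card (fst ` C) \<le> card (nodes1 n - S)"
            using 2 cy(1) by (intro card_mono) (auto simp: arcs_between_def)
          then have "3 \<le> r" using card_image[OF cy(3)] long(1) by (simp add: r_def)
          have "sum y C = (\<Sum>e\<in>C. 2 / r)"
            using notS arcC outside by (intro sum.cong) auto
          also have "\<dots> \<le> (\<Sum>e\<in>C. 2 / 3)"
            using \<open>3 \<le> r\<close> by (intro sum_mono divide_left_mono) auto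
          finally have "sum y C \<le> real (card C) - 1" using long(1) by simp
          then show ?thesis using bound weaker by simp
        next
          case 3
          obtain i j where ij: "(i, j) \<in> C" "i \<in> S" using 3(1) by force
          obtain i' j' where ij': "(i', j') \<in> C" "i' \<in> - S" using 3(2) by force
          have "fst ` C - - S \<noteq> {}" using 3(1) by blast
          obtain p q where pq: "(p, q) \<in> C" "p \<in> S" "q \<notin> S"
            using cycle_leaves[OF C ij 3(2)] by blast
          obtain p' q' where pq': "(p', q') \<in> C" "p' \<notin> S" "q' \<in> S"
            using cycle_leaves[OF C ij' \<open>fst ` C - - S \<noteq> {}\<close>] by blast
          have "sum y C = y (p, q) + y (p', q') + sum y (C - {(p, q), (p', q')})"
          proof -
            have "sum y C = sum y {(p, q), (p', q')} + sum y (C - {(p, q), (p', q')})"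
              using pq pq' cy(2) by (subst add.commute, intro sum.subset_diff) auto
            moreover have "p \<noteq> p'" using pq pq' by blast
            ultimately show ?thesis by simp
          qed
          also have "sum y (C - {(p, q), (p', q')}) \<le> (\<Sum>e\<in>C - {(p, q), (p', q')}. 1)"
            using arcC y_le_1 by (intro sum_mono) auto
          also have "\<dots> = real (card C) - 2"
          proof -
            have "p \<noteq> p'" using pq pq' by blast
            then have "card {(p, q), (p', q')} = 2" by simp
            then show ?thesis
              using pq pq' cy(2,6) by (simp add: card_Diff_subset of_nat_diff)
          qed
          finally have "sum y C \<le> real (card C) - 1"
            using crossing[OF arcC[OF pq(1)]] crossing[OF arcC[OF pq'(1)]] pq pq' by simp
          then show ?thesis using bound weaker by simp
        qed
      qed
    qed (rule x)
    then show ?thesis by (auto simp: Cl_def)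
  qed
  ultimately show ?thesis by blast
qed

section \<open>Strictness\<close>

text \<open>
  For \<open>n \<ge> 5\<close> the triangle on \<open>2, 3, 4\<close> has at most \<open>n - 2\<close> nodes, so it is an instance for all three
  violation results. Each violated inequality is valid for the smaller closure, being its DL or subtour
  inequality for a suitable parameter.
\<close>

lemma triangle:
  assumes "5 \<le> n"
  shows "{(2, 3), (3, 4), (4, 2)} \<in> cycles1 n"
  using assms by (intro three_cycle_in_cycles1) (auto simp: nodes1_def nodes_def)

lemma DL_V_strict_subset_MTZ_D:
  assumes n: "5 \<le> n"
  shows "Cl (P_DL n) (V_MTZ n) \<noteq> Cl (P_MTZ n) (D_set n)"
proof
  assume eq: "Cl (P_DL n) (V_MTZ n) = Cl (P_MTZ n) (D_set n)"
  let ?C = "{(2, 3), (3, 4), (4, 2)} :: (nat \<times> nat) set"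
  have "cycle_succ ?C 2 = 3" "cycle_pred ?C 2 = 4" by (auto simp: cycle_succ_def cycle_pred_def)
  moreover have "(2::nat) \<in> Field ?C" by (auto simp: Field_def)
  ultimately obtain x where x: "x \<in> Cl (P_MTZ n) (D_set n)"
    "\<not> (\<Sum>(i, j)\<in>?C. x (i, j) + x (j, i)) - x (3, 2) - x (2, 4) \<le> real (card ?C) - 1"
    using MTZ_violation[OF triangle[OF n], of 2] n by fastforce
  have N: "2 \<in> nodes1 n" "3 \<in> nodes1 n" "4 \<in> nodes1 n" using n by (auto simp: nodes1_def nodes_def)
  then have "x \<in> P_DL n (d_MTZ n 2)" using x(1) eq by (auto simp: Cl_def V_MTZ_def)
  then have "sum (dl_term (d_MTZ n 2) x) ?C \<le> card ?C" using triangle[OF n] P_DL_iff by blast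
  then show False using x(2) N by (simp add: dl_term_def d_MTZ_def arcs_between_def)
qed

lemma DL_D_strict_subset_DL_V:
  assumes n: "5 \<le> n"
  shows "Cl (P_DL n) (D_set n) \<noteq> Cl (P_DL n) (V_MTZ n)"
proof
  assume eq: "Cl (P_DL n) (D_set n) = Cl (P_DL n) (V_MTZ n)"
  let ?C = "{(2, 3), (3, 4), (4, 2)} :: (nat \<times> nat) set"
  obtain x where x: "x \<in> Cl (P_DL n) (V_MTZ n)"
    "\<not> (\<Sum>(i, j)\<in>?C. x (i, j) + x (j, i)) - x (3, 2) \<le> real (card ?C) - 1"
    using DL_V_violation[OF triangle[OF n], of 2 3] n by fastforce
  (* Putting the whole parameter on one arc of the cycle removes exactly its reversal from
     the DL inequality. *)
  define d :: "nat \<times> nat \<Rightarrow> real" where "d = restrict (\<lambda>a. if a = (2, 3) then 1 else 0) (arcsA1 n)"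
  have "sum d C \<le> 1" if C: "C \<in> cycles1 n" for C
  proof -
    have "sum d C = (\<Sum>a\<in>C. if a = (2, 3) then 1 else 0)"
      using cycles1D(1)[OF C] by (intro sum.cong) (auto simp: d_def)
    then show ?thesis using cycles1D(2)[OF C] by simp
  qed
  then have "d \<in> Dbar_set n" by (auto simp: Dbar_set_def d_def)
  then have "x \<in> P_DL n d" using x(1) eq Cl_DL_D_subset n by auto
  then have "sum (dl_term d x) ?C \<le> card ?C" using triangle[OF n] P_DL_iff by blast
  moreover have "2 \<in> nodes1 n" "3 \<in> nodes1 n" "4 \<in> nodes1 n" using n by (auto simp: nodes1_def nodes_def)
  ultimately show False using x(2) by (simp add: dl_term_def d_def arcs_between_def)
qed

lemma SCF_B_strict_subset_DL_D:
  assumes n: "5 \<le> n"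
  shows "Cl (P_SCF n) (B_set n) \<noteq> Cl (P_DL n) (D_set n)"
proof
  assume eq: "Cl (P_SCF n) (B_set n) = Cl (P_DL n) (D_set n)"
  have S: "{2, 3, 4} \<subseteq> nodes1 n" using n by (auto simp: nodes1_def nodes_def)
  obtain x where "x \<in> Cl (P_DL n) (D_set n)"
    "\<not> sum x (arcs_between {2, 3, 4}) \<le> real (card {2, 3, 4 :: nat}) - 1"
    using DL_D_violation[OF S] n by fastforce
  then show False using Cl_SCF_subtour[of x n "{2, 3, 4}"] eq S n by auto
qed

lemma arcs_in_eq: "S \<subseteq> nodes1 n \<Longrightarrow> arcs_in n S = arcs_between S"
  by (auto simp: arcs_in_def arcs_between_def nodes1_def)

theorem proposition33:
  fixes n :: nat
  assumes n_ge_4: "n \<ge> 4"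
  shows
    "(Cl (P_SCF n) (B_set n) \<subseteq> Cl (P_DL n) (D_set n) \<and>
      Cl (P_DL n) (D_set n) \<subseteq> Cl (P_DL n) (V_MTZ n) \<and>
      Cl (P_DL n) (V_MTZ n) \<subseteq> Cl (P_MTZ n) (D_set n))
   \<and> (n = 4 \<longrightarrow>
      Cl (P_SCF n) (B_set n) = Cl (P_DL n) (D_set n) \<and>
      Cl (P_DL n) (D_set n) = Cl (P_DL n) (V_MTZ n) \<and>
      Cl (P_DL n) (V_MTZ n) = Cl (P_MTZ n) (D_set n))
   \<and> (n \<ge> 5 \<longrightarrow>
      (\<forall>C\<in>cycles1 n. 3 \<le> card C \<and> card C \<le> n - 2 \<longrightarrow>
        (\<forall>k\<in>Field C. \<exists>x\<in>Cl (P_MTZ n) (D_set n).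
          \<not> (\<Sum>(i, j)\<in>C. x (i, j) + x (j, i)) - x (cycle_succ C k, k) - x (k, cycle_pred C k)
              \<le> real (card C) - 1)) \<and>
      Cl (P_DL n) (V_MTZ n) \<subset> Cl (P_MTZ n) (D_set n))
   \<and> (n \<ge> 5 \<longrightarrow>
      (\<forall>C\<in>cycles1 n. 3 \<le> card C \<and> card C \<le> n - 2 \<longrightarrow>
        (\<forall>(k, l)\<in>C. \<exists>x\<in>Cl (P_DL n) (V_MTZ n).
          \<not> (\<Sum>(i, j)\<in>C. x (i, j) + x (j, i)) - x (l, k) \<le> real (card C) - 1)) \<and>
      Cl (P_DL n) (D_set n) \<subset> Cl (P_DL n) (V_MTZ n))
   \<and> (n \<ge> 5 \<longrightarrow>
      (\<forall>S\<in>node_sets1 n. 3 \<le> card S \<and> card S \<le> n - 2 \<longrightarrow>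
        (\<exists>x\<in>Cl (P_DL n) (D_set n).
          \<not> (\<Sum>a\<in>arcs_in n S. x a) \<le> real (card S) - 1)) \<and>
      Cl (P_SCF n) (B_set n) \<subset> Cl (P_DL n) (D_set n))"
proof -
  have chain: "Cl (P_SCF n) (B_set n) \<subseteq> Cl (P_DL n) (D_set n)"
    "Cl (P_DL n) (D_set n) \<subseteq> Cl (P_DL n) (V_MTZ n)"
    "Cl (P_DL n) (V_MTZ n) \<subseteq> Cl (P_MTZ n) (D_set n)"
    using n_ge_4 Cl_SCF_B_subset_Cl_DL_D Cl_DL_D_subset_Cl_DL_V Cl_DL_V_subset_Cl_MTZ_D by simp_all
  have four: "Cl (P_MTZ n) (D_set n) \<subseteq> Cl (P_SCF n) (B_set n)" if "n = 4"
    using Cl_MTZ_D_four_subset_Cl_SCF_B that by simp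
  have sub: "\<exists>x\<in>Cl (P_DL n) (D_set n). \<not> (\<Sum>a\<in>arcs_in n S. x a) \<le> real (card S) - 1"
    if "S \<in> node_sets1 n" "3 \<le> card S" "card S \<le> n - 2" for S
    using DL_D_violation[of S n] arcs_in_eq[of S n] that by (simp add: node_sets1_def)
  show ?thesis
    using chain four MTZ_violation DL_V_violation sub
      DL_V_strict_subset_MTZ_D DL_D_strict_subset_DL_V SCF_B_strict_subset_DL_D
    by (intro conjI impI ballI; (elim conjE)?) (auto simp: psubset_eq)
qed

end
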